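(* Let $P$ be a finite poset whose Hasse diagram is a rooted tree with root $\rho$, $S=\Bbbk[x_{[2]\times P}]$ and $L=L(2,P)$. (1) Let $p\in P$, $p\ne\rho$, with children $b^1,\dots,b^m$, and let $q\in P$ be such that the meet of $q$ and $p$ is the parent of $p$. Then the map $L\to S/L$ sending $p_1p_2\mapsto q_2\prod_{i=1}^m b^i_1$ and all other monomial generators of $L$ to zero defines an element of $T^1(S/L)$. (2) Let $b^1,\dots,b^m$ be the children of the root $\rho$. Then the map $L\to S/L$ sending $\rho_1\rho_2\mapsto\prod_{i=1}^m b^i_1$ and all other monomial generators of $L$ to zero defines an element of $T^1(S/L)$. As $q$ and $p$ vary, these maps generate $T^1(S/L)$ (as an $S$-module).
   Context: $\Bbbk$ is a field. The Hasse diagram of $P$ is a rooted tree with the root at the bottom: $P$ has a unique minimal element $\rho$ (the root), and every $p\ne\rho$ covers exactly one element, its parent; the children of $p$ are the elements covering $p$. For $p\in P$ and $i\in\{1,2\}$ there is a variable $x_{i,p}$, written $p_i$; $\Bbbk[x_{[2]\times P}]$ is the polynomial ring in these variables. $L(2,P)$ is the ideal generated by the monomials $p_1q_2$ for all $p\le q$ in $P$. $T^1(S/L)$ is the cokernel of the map $\delta^*:\mathrm{Der}_\Bbbk(S)\to\mathrm{Hom}_S(L,S/L)$ sending a derivation $\partial$ to the homomorphism $f\mapsto\partial f+L$; a homomorphism $L\to S/L$ defines an element of $T^1(S/L)$ via its class. *)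

theory Defs
  imports
    "HOL-Library.Poly_Mapping"
    "HOL-Library.Numeral_Type"
    "HOL-Algebra.Algebra"
    "HOL-Algebra.Algebraic_Closure_Type"
begin

section \<open>Rooted trees\<close>

definition covers :: "'p::order \<Rightarrow> 'p \<Rightarrow> bool" where
  "covers p a \<longleftrightarrow> a < p \<and> (\<nexists>z. a < z \<and> z < p)"

definition rooted_tree :: "'p::order \<Rightarrow> bool" where
  "rooted_tree \<rho> \<longleftrightarrow>
     (\<forall>x. (\<nexists>y. y < x) \<longleftrightarrow> x = \<rho>) \<and> (\<forall>p. p \<noteq> \<rho> \<longrightarrow> (\<exists>!a. covers p a))"

definition parent :: "'p::order \<Rightarrow> 'p" where
  "parent p = (THE a. covers p a)"

definition children :: "'p::order \<Rightarrow> 'p set" where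
  "children p = {b. covers b p}"

definition is_meet :: "'p::order \<Rightarrow> 'p \<Rightarrow> 'p \<Rightarrow> bool" where
  "is_meet m x y \<longleftrightarrow> m \<le> x \<and> m \<le> y \<and> (\<forall>z. z \<le> x \<and> z \<le> y \<longrightarrow> z \<le> m)"


section \<open>Polynomial rings and derivations\<close>

type_synonym ('v, 'k) mpoly = "('v \<Rightarrow>\<^sub>0 nat) \<Rightarrow>\<^sub>0 'k"

definition Cst :: "'k::field \<Rightarrow> ('v, 'k) mpoly" where
  "Cst c = Poly_Mapping.single 0 c"

definition Var :: "'v \<Rightarrow> ('v, 'k::field) mpoly" where
  "Var v = Poly_Mapping.single (Poly_Mapping.single v 1) 1"

abbreviation PolyRing :: "('v, 'k::field) mpoly ring" where
  "PolyRing \<equiv> ring_of_type_algebra"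

definition Der :: "(('v, 'k::field) mpoly \<Rightarrow> ('v, 'k) mpoly) set" where
  "Der = {D. (\<forall>f g. D (f + g) = D f + D g)
           \<and> (\<forall>c f. D (Cst c * f) = Cst c * D f)
           \<and> (\<forall>f g. D (f * g) = f * D g + g * D f)}"


section \<open>Modules\<close>

text \<open>The library represents modules by records that also carry fields for a multiplication and
  a unit; these play no role in a module and are left undefined. In \<open>M/K\<close> the coset of \<open>r x\<close> is
  the same for every \<open>x\<close> in a coset \<open>A\<close>, so the union below is just that coset.\<close>

definition quot_module ::
    "('r, 'm) module \<Rightarrow> 'm set \<Rightarrow> ('r, 'm set) module" where
  "quot_module M K =
     \<lparr>carrier = a_rcosets\<^bsub>M\<^esub> K, monoid.mult = undefined, one = undefined,
      ring.zero = K, add = set_add M,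
      module.smult = (\<lambda>r A. \<Union>x\<in>A. (K +>\<^bsub>M\<^esub> (r \<odot>\<^bsub>M\<^esub> x)))\<rparr>"

definition module_span ::
    "('r, 'a) ring_scheme \<Rightarrow> ('r, 'm, 'b) module_scheme \<Rightarrow> 'm set \<Rightarrow> 'm set" where
  "module_span R M A = \<Inter>{H. submodule H R M \<and> A \<subseteq> H}"

text \<open>\<open>Hom\<^sub>R(I, R/I)\<close> as an \<open>R\<close>-module. The homomorphisms are extensional, so that they are
  determined by their values on \<open>I\<close>; \<open>r\<close> acts on \<open>R/I\<close> as multiplication by its residue class.\<close>

definition Hom_quot :: "'r ring \<Rightarrow> 'r set \<Rightarrow> ('r, 'r \<Rightarrow> 'r set) module" where
  "Hom_quot R I =
     \<lparr>carrier = {\<phi> \<in> I \<rightarrow>\<^sub>E carrier (R Quot I).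
        (\<forall>f\<in>I. \<forall>g\<in>I. \<phi> (f \<oplus>\<^bsub>R\<^esub> g) = \<phi> f \<oplus>\<^bsub>R Quot I\<^esub> \<phi> g) \<and>
        (\<forall>r\<in>carrier R. \<forall>f\<in>I. \<phi> (r \<otimes>\<^bsub>R\<^esub> f) = (I +>\<^bsub>R\<^esub> r) \<otimes>\<^bsub>R Quot I\<^esub> \<phi> f)},
      monoid.mult = undefined, one = undefined,
      ring.zero = (\<lambda>f\<in>I. \<zero>\<^bsub>R Quot I\<^esub>),
      add = (\<lambda>\<phi> \<psi>. \<lambda>f\<in>I. \<phi> f \<oplus>\<^bsub>R Quot I\<^esub> \<psi> f),
      module.smult = (\<lambda>r \<phi>. \<lambda>f\<in>I. (I +>\<^bsub>R\<^esub> r) \<otimes>\<^bsub>R Quot I\<^esub> \<phi> f)\<rparr>"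


section \<open>The first cotangent cohomology\<close>

definition delta ::
    "('v, 'k::field) mpoly set \<Rightarrow> (('v, 'k) mpoly \<Rightarrow> ('v, 'k) mpoly)
     \<Rightarrow> ('v, 'k) mpoly \<Rightarrow> ('v, 'k) mpoly set" where
  "delta L D = (\<lambda>f\<in>L. L +>\<^bsub>PolyRing\<^esub> D f)"

definition T1 ::
    "('v, 'k::field) mpoly set
     \<Rightarrow> (('v, 'k) mpoly, (('v, 'k) mpoly \<Rightarrow> ('v, 'k) mpoly set) set) module" where
  "T1 L = quot_module (Hom_quot PolyRing L) (delta L ` Der)"

definition T1_class ::
    "('v, 'k::field) mpoly set \<Rightarrow> (('v, 'k) mpoly \<Rightarrow> ('v, 'k) mpoly set)
     \<Rightarrow> (('v, 'k) mpoly \<Rightarrow> ('v, 'k) mpoly set) set" where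
  "T1_class L \<phi> = (delta L ` Der) +>\<^bsub>Hom_quot PolyRing L\<^esub> \<phi>"


section \<open>The letterplace ideal\<close>

text \<open>The set \<open>[2]\<close> is rendered by the two-element type \<open>2\<close>, whose elements are \<open>1\<close> and
  \<open>2\<close> (the latter also being \<open>0\<close>, as arithmetic in this type is modulo \<open>2\<close>).\<close>

abbreviation xvar :: "2 \<Rightarrow> 'p \<Rightarrow> (2 \<times> 'p, 'k::field) mpoly" where
  "xvar i p \<equiv> Var (i, p)"

definition letterplace :: "(2 \<times> 'p::order, 'k::field) mpoly set" where
  "letterplace = Idl\<^bsub>PolyRing\<^esub> {xvar 1 p * xvar 2 q | p q. p \<le> q}"

text \<open>The homomorphisms \<open>L \<rightarrow> S/L\<close> with \<open>p\<^sub>1p\<^sub>2 \<mapsto> f\<close> that send all other monomial generators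
  of \<open>L = L(2, P)\<close> to zero; as the generators generate \<open>L\<close>, there is at most one.\<close>

definition special_homs ::
    "(2 \<times> 'p::order, 'k::field) mpoly set \<Rightarrow> 'p \<Rightarrow> (2 \<times> 'p, 'k) mpoly
     \<Rightarrow> ((2 \<times> 'p, 'k) mpoly \<Rightarrow> (2 \<times> 'p, 'k) mpoly set) set" where
  "special_homs L p f =
     {\<phi> \<in> carrier (Hom_quot PolyRing L).
        \<phi> (xvar 1 p * xvar 2 p) = L +>\<^bsub>PolyRing\<^esub> f \<and>
        (\<forall>a b. a \<le> b \<and> (a, b) \<noteq> (p, p) \<longrightarrow>
           \<phi> (xvar 1 a * xvar 2 b) = \<zero>\<^bsub>PolyRing Quot L\<^esub>)}"

end

theory Submission
  imports Defs
begin

text \<open>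
The ideal \<open>L\<close> is generated by monomials, so a polynomial lies in \<open>L\<close> if and only if each of its
monomials does. A homomorphism \<open>\<phi> : L \<rightarrow> S/L\<close> is given by the residue classes of polynomials \<open>f\<^sub>a\<^sub>b\<close>,
the images of \<open>a\<^sub>1b\<^sub>2\<close> for \<open>a \<le> b\<close>, and only the coefficients of \<open>f\<^sub>a\<^sub>b\<close> at monomials outside \<open>L\<close>
matter. The two families of linear syzygies, \<open>b'\<^sub>2 (a\<^sub>1b\<^sub>2) = b\<^sub>2 (a\<^sub>1b'\<^sub>2)\<close> and
\<open>a'\<^sub>1 (a\<^sub>1b\<^sub>2) = a\<^sub>1 (a'\<^sub>1b\<^sub>2)\<close>, compare these coefficients for different generators.

Sort the monomials \<open>n \<notin> L\<close> of \<open>f\<^sub>a\<^sub>b\<close> by whether they contain \<open>a\<^sub>1\<close> or \<open>b\<^sub>2\<close>; they cannot contain both.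
If \<open>n = m b\<^sub>2\<close>, the first family says that the coefficient depends only on \<open>a\<close> and \<open>m\<close>. So all
these terms come from one polynomial \<open>g\<^sub>a\<close>, and they are the values of the derivation
\<open>g\<^sub>a \<partial>/\<partial>a\<^sub>1\<close>. The terms with \<open>n = m a\<^sub>1\<close> similarly are values of derivations \<open>h\<^sub>b \<partial>/\<partial>b\<^sub>2\<close>.
If \<open>n\<close> contains neither variable, the syzygies force \<open>n b'\<^sub>2 \<in> L\<close> for all \<open>b' \<ge> a\<close> other than \<open>b\<close> and
\<open>n a'\<^sub>1 \<in> L\<close> for all \<open>a' \<le> b\<close> other than \<open>a\<close>. In a rooted tree this is so restrictive
(\<open>surviving_monomial\<close>) that \<open>a = b\<close>, that \<open>n\<close> contains \<open>c\<^sub>1\<close> for every child \<open>c\<close> of \<open>a\<close>, and that, unless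
\<open>a\<close> is the root, \<open>n\<close> contains some \<open>q\<^sub>2\<close> such that the meet of \<open>q\<close> and \<open>a\<close> is the parent of \<open>a\<close>. So \<open>n\<close> is
a multiple of the value at \<open>a\<^sub>1a\<^sub>2\<close> of one of the special homomorphisms. This gives \<open>hom_decomposition\<close>:
modulo the image of the derivations, \<open>\<phi>\<close> is a combination of special homomorphisms.

The special homomorphism with \<open>p\<^sub>1p\<^sub>2 \<mapsto> r\<close> is \<open>f \<mapsto> r \<cdot> c(f)\<close>, where \<open>c\<close> divides the monomials divisible
by \<open>p\<^sub>1p\<^sub>2\<close> by \<open>p\<^sub>1p\<^sub>2\<close> and kills the others. It is linear over \<open>S\<close> modulo \<open>L\<close> as soon as \<open>b\<^sub>2 r \<in> L\<close> for
all \<open>b > p\<close> and \<open>a\<^sub>1 r \<in> L\<close> for all \<open>a < p\<close> (\<open>lifts_hom_contract_at\<close>). For the first condition the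
children of \<open>p\<close> are responsible, since one of them lies below \<open>b\<close>; for the second one the
factor \<open>q\<^sub>2\<close> is, since \<open>a\<close> lies below the parent of \<open>p\<close> and hence below \<open>q\<close>.
\<close>

section \<open>Modules and their quotients\<close>

lemma polyring_simps [simp]:
  "carrier (ring_of_type_algebra :: 'a::comm_ring_1 ring) = UNIV"
  "x \<otimes>\<^bsub>ring_of_type_algebra\<^esub> y = x * (y::'a)"
  "x \<oplus>\<^bsub>ring_of_type_algebra\<^esub> y = x + y"
  "\<zero>\<^bsub>(ring_of_type_algebra :: 'a ring)\<^esub> = 0"
  "\<one>\<^bsub>(ring_of_type_algebra :: 'a ring)\<^esub> = 1"
  by (auto simp: ring_of_type_algebra_def)

lemma submodule_is_abelian_subgroup:
  assumes "module R M" "submodule K R M"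
  shows "abelian_subgroup K M"
proof -
  interpret module R M by fact
  interpret K: submodule K R M by fact
  show ?thesis
    by (intro abelian_subgroupI3 additive_subgroup.intro K.subgroup_axioms) (rule abelian_group_axioms)
qed

text \<open>The union in the definition of the scalar multiplication runs over equal cosets, because \<open>K\<close> is
  closed under scalars.\<close>

lemma quot_module_smult_coset:
  assumes "module R M" "submodule K R M" "r \<in> carrier R" "x \<in> carrier M"
  shows "r \<odot>\<^bsub>quot_module M K\<^esub> (K +>\<^bsub>M\<^esub> x) = K +>\<^bsub>M\<^esub> (r \<odot>\<^bsub>M\<^esub> x)"
proof -
  interpret module R M by fact
  interpret K: submodule K R M by fact
  interpret KA: abelian_subgroup K M by (rule submodule_is_abelian_subgroup[OF assms(1,2)])
  have "K +>\<^bsub>M\<^esub> (r \<odot>\<^bsub>M\<^esub> y) = K +>\<^bsub>M\<^esub> (r \<odot>\<^bsub>M\<^esub> x)" if y: "y \<in> K +>\<^bsub>M\<^esub> x" for y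
  proof -
    obtain k where k: "k \<in> K" "y = k \<oplus>\<^bsub>M\<^esub> x" using y by (auto simp: a_r_coset_def')
    have "r \<odot>\<^bsub>M\<^esub> y = r \<odot>\<^bsub>M\<^esub> k \<oplus>\<^bsub>M\<^esub> r \<odot>\<^bsub>M\<^esub> x"
      using k assms(3,4) KA.a_subset by (auto intro: smult_r_distr)
    moreover have "r \<odot>\<^bsub>M\<^esub> k \<in> K" using k assms(3) by simp
    ultimately have "r \<odot>\<^bsub>M\<^esub> y \<in> K +>\<^bsub>M\<^esub> (r \<odot>\<^bsub>M\<^esub> x)" by (auto simp: a_r_coset_def')
    then show ?thesis using assms(3,4)
      by (metis KA.a_repr_independence' smult_closed)
  qed
  moreover have "x \<in> K +>\<^bsub>M\<^esub> x" using assms(4) by (rule KA.a_rcos_self)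
  ultimately have "(\<Union>y\<in>K +>\<^bsub>M\<^esub> x. K +>\<^bsub>M\<^esub> (r \<odot>\<^bsub>M\<^esub> y)) = K +>\<^bsub>M\<^esub> (r \<odot>\<^bsub>M\<^esub> x)"
    by blast
  then show ?thesis by (simp add: quot_module_def)
qed

lemma quot_module_carrier: "carrier (quot_module M K) = (\<lambda>x. K +>\<^bsub>M\<^esub> x) ` carrier M"
  by (auto simp: quot_module_def A_RCOSETS_def')

lemma quot_module_add_coset:
  assumes "module R M" "submodule K R M" "x \<in> carrier M" "y \<in> carrier M"
  shows "(K +>\<^bsub>M\<^esub> x) \<oplus>\<^bsub>quot_module M K\<^esub> (K +>\<^bsub>M\<^esub> y) = K +>\<^bsub>M\<^esub> (x \<oplus>\<^bsub>M\<^esub> y)"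
  using abelian_subgroup.a_rcos_sum[OF submodule_is_abelian_subgroup[OF assms(1,2)] assms(3,4)]
  by (simp add: quot_module_def)

lemma carrier_submodule_quot_module:
  assumes "module R M" "submodule K R M"
  shows "submodule (carrier (quot_module M K)) R (quot_module M K)"
proof -
  interpret module R M by fact
  interpret Q: group "M A_Mod K"
    by (rule abelian_subgroup.a_factorgroup_is_group[OF submodule_is_abelian_subgroup[OF assms]])
  have Q: "carrier (quot_module M K) = carrier (M A_Mod K)"
    "\<zero>\<^bsub>quot_module M K\<^esub> = \<one>\<^bsub>M A_Mod K\<^esub>"
    "x \<oplus>\<^bsub>quot_module M K\<^esub> y = x \<otimes>\<^bsub>M A_Mod K\<^esub> y" for x y
    by (simp_all add: quot_module_def A_FactGroup_def')
  have "group (add_monoid (quot_module M K))"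
  proof (rule groupI)
    fix x assume "x \<in> carrier (add_monoid (quot_module M K))"
    then show "\<exists>y\<in>carrier (add_monoid (quot_module M K)).
        y \<otimes>\<^bsub>add_monoid (quot_module M K)\<^esub> x = \<one>\<^bsub>add_monoid (quot_module M K)\<^esub>"
      by (intro bexI[of _ "inv\<^bsub>M A_Mod K\<^esub> x"]) (auto simp: Q simp del: add_A_FactGroup)
  qed (auto simp: Q Q.m_assoc simp del: add_A_FactGroup)
  from group.subgroup_self[OF this] have "subgroup (carrier (quot_module M K)) (add_monoid (quot_module M K))"
    by simp
  then show ?thesis
    by (intro submodule.intro submodule_axioms.intro)
      (auto simp: quot_module_carrier quot_module_smult_coset[OF assms])
qed

text \<open>Generation of a quotient can be tested upstairs: the elements of \<open>M\<close> whose coset lies in a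
  given submodule of \<open>M/K\<close> are closed under the operations and contain \<open>K\<close>.\<close>

lemma module_span_quot_module:
  assumes M: "module R M" and K: "submodule K R M" and A: "A \<subseteq> carrier M"
    and gen: "\<And>N x. \<lbrakk>A \<subseteq> N; K \<subseteq> N; N \<subseteq> carrier M;
      \<And>x y. x \<in> N \<Longrightarrow> y \<in> N \<Longrightarrow> x \<oplus>\<^bsub>M\<^esub> y \<in> N;
      \<And>r x. r \<in> carrier R \<Longrightarrow> x \<in> N \<Longrightarrow> r \<odot>\<^bsub>M\<^esub> x \<in> N; x \<in> carrier M\<rbrakk> \<Longrightarrow> x \<in> N"
  shows "module_span R (quot_module M K) ((\<lambda>x. K +>\<^bsub>M\<^esub> x) ` A) = carrier (quot_module M K)"
proof
  have "(\<lambda>x. K +>\<^bsub>M\<^esub> x) ` A \<subseteq> carrier (quot_module M K)"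
    using A by (auto simp: quot_module_carrier)
  then show "module_span R (quot_module M K) ((\<lambda>x. K +>\<^bsub>M\<^esub> x) ` A) \<subseteq> carrier (quot_module M K)"
    using carrier_submodule_quot_module[OF M K] by (auto simp: module_span_def)
next
  interpret M: module R M by fact
  interpret KA: abelian_subgroup K M by (rule submodule_is_abelian_subgroup[OF M K])
  have "K +>\<^bsub>M\<^esub> x \<in> H"
    if H: "submodule H R (quot_module M K)" and AH: "(\<lambda>x. K +>\<^bsub>M\<^esub> x) ` A \<subseteq> H" and x: "x \<in> carrier M"
    for H x
  proof -
    interpret H: submodule H R "quot_module M K" by fact
    define N where "N = {y \<in> carrier M. K +>\<^bsub>M\<^esub> y \<in> H}"
    have "x \<in> N"
    proof (rule gen[OF _ _ _ _ _ x])
      show "A \<subseteq> N" using A AH by (auto simp: N_def)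
      show "K \<subseteq> N"
      proof
        fix k assume k: "k \<in> K"
        have "K \<in> H" using H.one_closed by (simp add: quot_module_def)
        then show "k \<in> N" using KA.a_rcos_const[OF k] k KA.a_subset by (auto simp: N_def)
      qed
      show "N \<subseteq> carrier M" by (auto simp: N_def)
      show "y \<oplus>\<^bsub>M\<^esub> z \<in> N" if "y \<in> N" "z \<in> N" for y z
        using that H.m_closed[of "K +>\<^bsub>M\<^esub> y" "K +>\<^bsub>M\<^esub> z"]
        by (auto simp: N_def quot_module_add_coset[OF M K])
      show "r \<odot>\<^bsub>M\<^esub> y \<in> N" if "r \<in> carrier R" "y \<in> N" for r y
        using that H.smult_closed[of r "K +>\<^bsub>M\<^esub> y"]
        by (auto simp: N_def quot_module_smult_coset[OF M K])
    qed
    then show ?thesis by (simp add: N_def)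
  qed
  then show "carrier (quot_module M K) \<subseteq> module_span R (quot_module M K) ((\<lambda>x. K +>\<^bsub>M\<^esub> x) ` A)"
    by (auto simp: module_span_def quot_module_carrier)
qed

section \<open>Homomorphisms from an ideal to the residue class ring\<close>

lemma ideal_of_type_algebraI:
  fixes J :: "'a::comm_ring_1 set"
  assumes "0 \<in> J" and add: "\<And>f g. f \<in> J \<Longrightarrow> g \<in> J \<Longrightarrow> f + g \<in> J" and mult: "\<And>r f. f \<in> J \<Longrightarrow> r * f \<in> J"
  shows "ideal J ring_of_type_algebra"
proof (rule idealI)
  interpret RR: cring "ring_of_type_algebra :: 'a ring" by (rule cring_from_type_algebra)
  show "ring (ring_of_type_algebra :: 'a ring)" by (rule ring_from_type_algebra)
  show "subgroup J (add_monoid ring_of_type_algebra)"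
  proof (rule group.subgroupI[OF RR.a_group])
    show "J \<noteq> {}" using \<open>0 \<in> J\<close> by auto
    fix a assume "a \<in> J"
    have "inv\<^bsub>add_monoid ring_of_type_algebra\<^esub> a = - a"
      by (rule group.inv_equality[OF RR.a_group]) auto
    then show "inv\<^bsub>add_monoid ring_of_type_algebra\<^esub> a \<in> J"
      using mult[OF \<open>a \<in> J\<close>, of "-1"] by simp
  qed (auto simp: add)
qed (use mult in \<open>auto simp: mult.commute\<close>)

text \<open>A homomorphism \<open>I \<rightarrow> R/I\<close> has cosets as values. It is more convenient to calculate with a
  function on \<open>R\<close> that picks representatives of them; on \<open>I\<close> it is determined modulo \<open>I\<close>, and outside
  of \<open>I\<close> it is arbitrary.\<close>

definition lifts_hom :: "'a::comm_ring_1 set \<Rightarrow> ('a \<Rightarrow> 'a) \<Rightarrow> bool" where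
  "lifts_hom I F \<longleftrightarrow>
     (\<forall>f\<in>I. \<forall>g\<in>I. F (f + g) - (F f + F g) \<in> I) \<and> (\<forall>r. \<forall>f\<in>I. F (r * f) - r * F f \<in> I)"

definition hom_of :: "'a::comm_ring_1 set \<Rightarrow> ('a \<Rightarrow> 'a) \<Rightarrow> 'a \<Rightarrow> 'a set" where
  "hom_of I F = (\<lambda>f\<in>I. I +>\<^bsub>ring_of_type_algebra\<^esub> F f)"

locale type_ideal = ideal I "ring_of_type_algebra :: 'a::comm_ring_1 ring" for I
begin

abbreviation "RR \<equiv> ring_of_type_algebra :: 'a ring"
abbreviation "HH \<equiv> Hom_quot RR I"

lemma add_mem: "x \<in> I \<Longrightarrow> y \<in> I \<Longrightarrow> x + y \<in> I"
  using additive_subgroup.a_closed[OF additive_subgroup_axioms] by simp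

lemma mult_mem: "x \<in> I \<Longrightarrow> r * x \<in> I"
  using I_l_closed[of x r] by simp

lemma zero_mem: "0 \<in> I" using additive_subgroup.zero_closed[OF additive_subgroup_axioms] by simp

lemma uminus_mem: "x \<in> I \<Longrightarrow> - x \<in> I" using mult_mem[of x "-1"] by simp

lemma diff_mem: "x \<in> I \<Longrightarrow> y \<in> I \<Longrightarrow> x - y \<in> I"
  using add_mem[of x "- y"] uminus_mem by simp

lemma sum_mem: "(\<And>i. i \<in> A \<Longrightarrow> f i \<in> I) \<Longrightarrow> sum f A \<in> I"
  by (induction A rule: infinite_finite_induct) (auto simp: zero_mem add_mem)

lemma coset_eq_iff: "I +>\<^bsub>RR\<^esub> x = I +>\<^bsub>RR\<^esub> y \<longleftrightarrow> x - y \<in> I"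
proof
  assume "I +>\<^bsub>RR\<^esub> x = I +>\<^bsub>RR\<^esub> y"
  moreover have "x \<in> I +>\<^bsub>RR\<^esub> x" by (rule a_rcos_self) simp
  ultimately obtain i where "i \<in> I" "x = i + y" by (auto simp: a_r_coset_def')
  then show "x - y \<in> I" by simp
next
  assume "x - y \<in> I"
  then have "x \<in> I +>\<^bsub>RR\<^esub> y" by (auto simp: a_r_coset_def' intro!: bexI[of _ "x - y"])
  then show "I +>\<^bsub>RR\<^esub> x = I +>\<^bsub>RR\<^esub> y" using a_repr_independence'[of x y] by simp
qed

lemma quot_simps:
  "(I +>\<^bsub>RR\<^esub> x) \<oplus>\<^bsub>RR Quot I\<^esub> (I +>\<^bsub>RR\<^esub> y) = I +>\<^bsub>RR\<^esub> (x + y)"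
  "(I +>\<^bsub>RR\<^esub> x) \<otimes>\<^bsub>RR Quot I\<^esub> (I +>\<^bsub>RR\<^esub> y) = I +>\<^bsub>RR\<^esub> (x * y)"
  "\<zero>\<^bsub>RR Quot I\<^esub> = I +>\<^bsub>RR\<^esub> 0"
  "carrier (RR Quot I) = range (\<lambda>x. I +>\<^bsub>RR\<^esub> x)"
proof -
  show "(I +>\<^bsub>RR\<^esub> x) \<oplus>\<^bsub>RR Quot I\<^esub> (I +>\<^bsub>RR\<^esub> y) = I +>\<^bsub>RR\<^esub> (x + y)"
    using a_rcos_sum[of x y] by (simp add: FactRing_def)
  show "(I +>\<^bsub>RR\<^esub> x) \<otimes>\<^bsub>RR Quot I\<^esub> (I +>\<^bsub>RR\<^esub> y) = I +>\<^bsub>RR\<^esub> (x * y)"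
    using rcoset_mult_add[of x y] by (simp add: FactRing_def)
  show "\<zero>\<^bsub>RR Quot I\<^esub> = I +>\<^bsub>RR\<^esub> 0"
    using a_coset_add_zero by (simp add: FactRing_def a_r_coset_def')
  show "carrier (RR Quot I) = range (\<lambda>x. I +>\<^bsub>RR\<^esub> x)"
    by (auto simp: FactRing_def A_RCOSETS_def')
qed

lemma hom_of_eq_iff: "hom_of I F = hom_of I G \<longleftrightarrow> (\<forall>f\<in>I. F f - G f \<in> I)"
  by (auto simp: hom_of_def fun_eq_iff restrict_def coset_eq_iff) 

lemma hom_of_carrier_iff: "hom_of I F \<in> carrier HH \<longleftrightarrow> lifts_hom I F"
  by (auto simp: Hom_quot_def hom_of_def lifts_hom_def quot_simps add_mem mult_mem coset_eq_iff)

lemma carrier_hom_ofE: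
  assumes "\<phi> \<in> carrier HH"
  obtains F where "\<phi> = hom_of I F" "lifts_hom I F"
proof -
  have "\<exists>x. \<phi> f = I +>\<^bsub>RR\<^esub> x" if "f \<in> I" for f
  proof -
    have "\<phi> f \<in> carrier (RR Quot I)" using assms that by (auto simp: Hom_quot_def)
    then show ?thesis by (auto simp: quot_simps)
  qed
  then obtain F where F: "\<And>f. f \<in> I \<Longrightarrow> \<phi> f = I +>\<^bsub>RR\<^esub> F f" by metis
  have "\<phi> = hom_of I F"
  proof
    fix f show "\<phi> f = hom_of I F f"
      using assms F by (cases "f \<in> I") (auto simp: hom_of_def Hom_quot_def PiE_def extensional_def)
  qed
  with assms show ?thesis using that hom_of_carrier_iff by blast
qed

lemma Hom_quot_simps:
  "hom_of I F \<oplus>\<^bsub>HH\<^esub> hom_of I G = hom_of I (\<lambda>f. F f + G f)"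
  "r \<odot>\<^bsub>HH\<^esub> hom_of I F = hom_of I (\<lambda>f. r * F f)"
  "\<zero>\<^bsub>HH\<^esub> = hom_of I (\<lambda>f. 0)"
  by (auto simp: Hom_quot_def hom_of_def quot_simps fun_eq_iff)

lemma lifts_hom_add: 
  assumes "lifts_hom I F" "lifts_hom I G" shows "lifts_hom I (\<lambda>f. F f + G f)"
  unfolding lifts_hom_def
proof (intro conjI ballI allI)
  fix f g assume "f \<in> I" "g \<in> I"
  then have "F (f + g) - (F f + F g) \<in> I" "G (f + g) - (G f + G g) \<in> I"
    using assms by (auto simp: lifts_hom_def)
  from add_mem[OF this] show "F (f + g) + G (f + g) - (F f + G f + (F g + G g)) \<in> I"
    by (simp add: algebra_simps)
next
  fix r f assume "f \<in> I"
  then have "F (r * f) - r * F f \<in> I" "G (r * f) - r * G f \<in> I"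
    using assms by (auto simp: lifts_hom_def)
  from add_mem[OF this] show "F (r * f) + G (r * f) - r * (F f + G f) \<in> I"
    by (simp add: algebra_simps)
qed

lemma lifts_hom_mult: 
  assumes "lifts_hom I F" shows "lifts_hom I (\<lambda>f. s * F f)"
  unfolding lifts_hom_def
proof (intro conjI ballI allI)
  fix f g assume "f \<in> I" "g \<in> I"
  then have "F (f + g) - (F f + F g) \<in> I"
    using assms by (auto simp: lifts_hom_def)
  from mult_mem[OF this] show "s * F (f + g) - (s * F f + s * F g) \<in> I"
    by (simp add: algebra_simps)
next
  fix r f assume "f \<in> I"
  then have "F (r * f) - r * F f \<in> I" 
    using assms by (auto simp: lifts_hom_def)
  from mult_mem[OF this, of s] show "s * F (r * f) - r * (s * F f) \<in> I"
    by (simp add: algebra_simps)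
qed

lemma lifts_hom_zero: "lifts_hom I (\<lambda>f. 0)"
  by (simp add: lifts_hom_def zero_mem)

lemma Hom_quot_module: "module RR HH"
proof (rule moduleI)
  show "cring RR" by (rule cring_from_type_algebra)
  show "abelian_group HH"
  proof (rule abelian_groupI)
    fix x assume "x \<in> carrier HH"
    then obtain F where F: "x = hom_of I F" "lifts_hom I F" by (rule carrier_hom_ofE)
    show "\<exists>y\<in>carrier HH. y \<oplus>\<^bsub>HH\<^esub> x = \<zero>\<^bsub>HH\<^esub>"
      using F lifts_hom_mult[of F "-1"]
      by (intro bexI[of _ "hom_of I (\<lambda>f. -1 * F f)"])
        (auto simp: Hom_quot_simps hom_of_carrier_iff)
  qed (auto elim!: carrier_hom_ofE simp: Hom_quot_simps hom_of_carrier_iff lifts_hom_add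
      lifts_hom_zero algebra_simps)
qed (auto elim!: carrier_hom_ofE simp: Hom_quot_simps hom_of_carrier_iff lifts_hom_mult algebra_simps)

end

text \<open>The elements that a homomorphism sends to zero form an ideal, so it is enough to test generators.\<close>

lemma lifts_hom_zero_on_genideal:
  assumes I: "I = Idl\<^bsub>ring_of_type_algebra\<^esub> A" and F: "lifts_hom I F" and A: "\<And>a. a \<in> A \<Longrightarrow> F a \<in> I"
    and f: "f \<in> (I :: 'a::comm_ring_1 set)"
  shows "F f \<in> I"
proof -
  interpret RR: cring "ring_of_type_algebra :: 'a ring" by (rule cring_from_type_algebra)
  interpret type_ideal I unfolding I type_ideal_def by (rule RR.genideal_ideal) simp
  define J where "J = {g \<in> I. F g \<in> I}"
  have mult: "r * g \<in> J" if "g \<in> J" for r g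
  proof -
    have "F (r * g) - r * F g \<in> I" using F that by (auto simp: lifts_hom_def J_def)
    then have "F (r * g) - r * F g + r * F g \<in> I" using that by (intro add_mem mult_mem) (auto simp: J_def)
    with that show ?thesis by (auto simp: J_def mult_mem)
  qed
  have add: "g + h \<in> J" if "g \<in> J" "h \<in> J" for g h
  proof -
    have "F (g + h) - (F g + F h) \<in> I" using F that by (auto simp: lifts_hom_def J_def)
    then have "F (g + h) - (F g + F h) + (F g + F h) \<in> I"
      using that by (intro add_mem) (auto simp: J_def)
    with that show ?thesis by (auto simp: J_def add_mem)
  qed
  have "F (0 * 0) - 0 * F 0 \<in> I"
    using F zero_mem by (simp add: lifts_hom_def del: mult_zero_left mult_zero_right)
  then have "0 \<in> J" by (simp add: J_def zero_mem)
  then have "ideal J RR" using add mult by (rule ideal_of_type_algebraI)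
  moreover have "A \<subseteq> J" using A RR.genideal_self[of A] by (auto simp: J_def I)
  ultimately have "I \<subseteq> J" unfolding I by (rule RR.genideal_minimal)
  with f show ?thesis by (auto simp: J_def)
qed

section \<open>Polynomials and their monomials\<close>

abbreviation "lookup \<equiv> Poly_Mapping.lookup"
abbreviation "keys \<equiv> Poly_Mapping.keys"
abbreviation "single \<equiv> Poly_Mapping.single"

definition expo :: "'v \<Rightarrow> 'v \<Rightarrow>\<^sub>0 nat" where
  "expo v = single v 1"

lemma lookup_expo: "lookup (expo v) w = (if w = v then 1 else 0)"
  by (simp add: expo_def lookup_single when_def)

lemma Var_expo: "Var v = single (expo v) 1"
  by (simp add: Var_def expo_def)

lemma monomial_decomposition: "f = (\<Sum>m\<in>keys f. single m (lookup f m))"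
proof (rule poly_mapping_eqI)
  fix n
  show "lookup f n = lookup (\<Sum>m\<in>keys f. single m (lookup f m)) n"
    by (auto simp: lookup_sum lookup_single when_def in_keys_iff)
qed

lemma monomial_induct:
  assumes "\<And>m c. P (single m c)" and add: "\<And>f g. P f \<Longrightarrow> P g \<Longrightarrow> P (f + g)"
  shows "P (f :: 'a \<Rightarrow>\<^sub>0 'b::comm_monoid_add)"
proof -
  have "P 0" using assms(1)[of undefined 0] by simp
  have "P (\<Sum>m\<in>A. single m (lookup f m))" for A
    by (induction A rule: infinite_finite_induct) (use \<open>P 0\<close> assms in auto)
  from this[of "keys f"] show ?thesis by (simp only: monomial_decomposition[symmetric])
qed

lemma expo_diff_add:
  fixes m n :: "'v \<Rightarrow>\<^sub>0 nat"
  assumes "\<And>v. lookup m v \<le> lookup n v"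
  shows "n - m + m = n"
  using assms by (intro poly_mapping_eqI) (simp add: lookup_add lookup_minus)

lemma lookup_single_mult:
  fixes f :: "('v \<Rightarrow>\<^sub>0 nat) \<Rightarrow>\<^sub>0 'k::comm_semiring_1"
  shows "lookup (single m c * f) (m + n) = c * lookup f n"
    and "(\<And>k. n \<noteq> m + k) \<Longrightarrow> lookup (single m c * f) n = 0"
  by (induction f rule: monomial_induct)
    (auto simp: mult_single lookup_single lookup_add distrib_left when_def)

lemma lookup_Var_mult: "lookup (Var v * f) (m + expo v) = lookup f m"
  using lookup_single_mult(1)[of "expo v" 1 f m] by (simp add: Var_expo add.commute)

lemma lookup_Var_mult_eq_0: "lookup n v = 0 \<Longrightarrow> lookup (Var v * f) n = 0"
  by (auto simp: Var_expo lookup_add lookup_expo intro!: lookup_single_mult(2))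

lemma prod_Var: "(\<Prod>b\<in>B. Var (h b)) = single (\<Sum>b\<in>B. expo (h b)) (1 :: 'k::field)"
  by (induction B rule: infinite_finite_induct) (auto simp: Var_expo mult_single)

lemma exists_polynomial:
  fixes c :: "'a \<Rightarrow> 'b::zero"
  assumes "finite A" "\<And>m. c m \<noteq> 0 \<Longrightarrow> m \<in> A"
  shows "\<exists>f. \<forall>m. lookup f m = c m"
proof -
  have "finite {m. c m \<noteq> 0}" by (rule finite_subset[OF _ assms(1)]) (use assms(2) in auto)
  then have "lookup (Abs_poly_mapping c) = c" by (rule lookup_Abs_poly_mapping)
  then show ?thesis by metis
qed

section \<open>Derivations and contractions\<close>

definition lin_ext :: "(('v \<Rightarrow>\<^sub>0 nat) \<Rightarrow> ('v, 'k::field) mpoly) \<Rightarrow> ('v, 'k) mpoly \<Rightarrow> ('v, 'k) mpoly" where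
  "lin_ext d f = (\<Sum>m\<in>keys f. Cst (lookup f m) * d m)"

lemma lin_ext_add: "lin_ext d (f + g) = lin_ext d f + lin_ext d g"
  unfolding lin_ext_def
  by (rule setsum_keys_plus_distrib) (auto simp: Cst_def single_add distrib_right)

lemma lin_ext_single: "lin_ext d (single m c) = Cst c * d m"
  by (cases "c = 0") (auto simp: lin_ext_def Cst_def)

text \<open>The derivation is the linear extension of \<open>x\<^sup>m \<mapsto> \<Sum>\<^sub>v G\<^sub>v \<partial>x\<^sup>m/\<partial>v\<close>; the Leibniz rule is bilinear, so
  it only has to be checked on monomials.\<close>

lemma derivation_exists:
  fixes G :: "'v::finite \<Rightarrow> ('v, 'k::field) mpoly"
  shows "\<exists>D\<in>Der. \<forall>v. D (Var v) = G v"
proof -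
  define pd :: "'v \<Rightarrow> ('v \<Rightarrow>\<^sub>0 nat) \<Rightarrow> ('v, 'k) mpoly"
    where "pd v m = single (m - expo v) (of_nat (lookup m v))" for v m
  define d where "d m = (\<Sum>v\<in>UNIV. G v * pd v m)" for m
  have shift: "single m 1 * pd v n = single (m + n - expo v) (of_nat (lookup n v))" for v m n
  proof (cases "lookup n v = 0")
    case False
    have "lookup (expo v) w \<le> lookup n w" for w using False by (simp add: lookup_expo)
    then have "m + (n - expo v) = m + n - expo v"
      by (intro poly_mapping_eqI) (simp add: lookup_add lookup_minus)
    then show ?thesis by (simp add: pd_def mult_single)
  qed (simp add: pd_def)
  have pd: "pd v (m + n) = single m 1 * pd v n + single n 1 * pd v m" for v m n
    unfolding shift by (simp add: pd_def lookup_add add.commute[of n m] single_add[symmetric] add.commute)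
  have d: "d (m + n) = single m 1 * d n + single n 1 * d m" for m n
    by (simp add: d_def pd sum_distrib_left sum.distrib algebra_simps)
  have Cst: "Cst (a * b) = Cst a * (Cst b :: ('v, 'k) mpoly)" "Cst a * single m b = single m (a * b)"
    for a b :: 'k and m :: "'v \<Rightarrow>\<^sub>0 nat"
    by (simp_all add: Cst_def mult_single)
  have sing: "single m c = Cst c * single m 1" for m :: "'v \<Rightarrow>\<^sub>0 nat" and c :: 'k
    by (simp add: Cst)
  have leib: "lin_ext d (f * g) = f * lin_ext d g + g * lin_ext d f" for f g
  proof (induction f rule: monomial_induct)
    case (1 m a)
    show ?case
    proof (induction g rule: monomial_induct)
      case (1 n b)
      show ?case
        unfolding mult_single lin_ext_single d Cst(1)
        unfolding sing[of m a] sing[of n b]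
        by (simp add: algebra_simps)
    qed (simp add: lin_ext_add algebra_simps)
  qed (simp add: lin_ext_add algebra_simps)
  have "lin_ext d (Cst c * f) = Cst c * lin_ext d f" for c f
  proof (induction f rule: monomial_induct)
    case (1 n b)
    show ?case by (simp add: Cst lin_ext_single mult.assoc)
  qed (simp add: lin_ext_add algebra_simps)
  with leib have "lin_ext d \<in> Der" by (simp add: Der_def lin_ext_add)
  moreover have "lin_ext d (Var v) = G v" for v
  proof -
    have "G w * pd w (expo v) = (if w = v then G v else 0)" for w
      by (simp add: pd_def lookup_expo)
    then have "d (expo v) = G v" by (simp add: d_def)
    then show ?thesis by (simp add: Var_expo lin_ext_single Cst_def)
  qed
  ultimately show ?thesis by blast
qed

text \<open>The linear map that divides the monomials divisible by \<open>x\<^sup>w\<close> by \<open>x\<^sup>w\<close> and kills the others.\<close>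

definition contract :: "('v \<Rightarrow>\<^sub>0 nat) \<Rightarrow> ('v, 'k::field) mpoly \<Rightarrow> ('v, 'k) mpoly" where
  "contract w f = Poly_Mapping.map_key (\<lambda>m. m + w) f"

lemma lookup_contract: "lookup (contract w f) m = lookup f (m + w)"
  unfolding contract_def by (subst map_key.rep_eq) (auto simp: inj_def)

lemma contract_add: "contract w (f + g) = contract w f + contract w g"
  by (rule poly_mapping_eqI) (simp add: lookup_contract lookup_add)

lemma contract_single: "contract w (single (m + w) c) = single m c"
  by (rule poly_mapping_eqI) (simp add: lookup_contract lookup_single)

lemma contract_single_eq_0: "(\<And>k. n \<noteq> k + w) \<Longrightarrow> contract w (single n c) = 0"
  by (rule poly_mapping_eqI) (auto simp: lookup_contract lookup_single when_def)

section \<open>The letterplace ideal\<close>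

definition in_lp :: "(2 \<times> 'p::order \<Rightarrow>\<^sub>0 nat) \<Rightarrow> bool" where
  "in_lp m \<longleftrightarrow> (\<exists>a b. a \<le> b \<and> lookup m (1, a) \<noteq> 0 \<and> lookup m (2, b) \<noteq> 0)"

lemma in_lp_add: "in_lp n \<Longrightarrow> in_lp (m + n)"
  by (fastforce simp: in_lp_def lookup_add)

lemma xvar_xvar: "xvar 1 a * xvar 2 b = single (expo (1, a) + expo (2, b)) 1"
  by (simp add: Var_expo mult_single)

lemma ideal_letterplace: "ideal (letterplace :: (2 \<times> 'p::order, 'k::field) mpoly set) PolyRing"
proof -
  interpret RR: cring "PolyRing :: (2 \<times> 'p::order, 'k::field) mpoly ring"
    by (rule cring_from_type_algebra)
  show ?thesis unfolding letterplace_def by (rule RR.genideal_ideal) simp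
qed

lemma type_ideal_letterplace: "type_ideal (letterplace :: (2 \<times> 'p::order, 'k::field) mpoly set)"
  unfolding type_ideal_def by (rule ideal_letterplace)

lemmas lp_zero_mem = type_ideal.zero_mem[OF type_ideal_letterplace]
  and lp_add_mem = type_ideal.add_mem[OF type_ideal_letterplace]
  and lp_diff_mem = type_ideal.diff_mem[OF type_ideal_letterplace]
  and lp_mult_mem = type_ideal.mult_mem[OF type_ideal_letterplace]
  and lp_sum_mem = type_ideal.sum_mem[OF type_ideal_letterplace]

lemma letterplace_gen:
  "a \<le> b \<Longrightarrow> xvar 1 a * xvar 2 b \<in> (letterplace :: (2 \<times> 'p::order, 'k::field) mpoly set)"
proof -
  interpret RR: cring "PolyRing :: (2 \<times> 'p::order, 'k::field) mpoly ring"
    by (rule cring_from_type_algebra)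
  show "xvar 1 a * xvar 2 b \<in> (letterplace :: (2 \<times> 'p, 'k) mpoly set)" if "a \<le> b"
    unfolding letterplace_def
    using that RR.genideal_self[of "{xvar 1 p * xvar 2 q | p q :: 'p. p \<le> q}"] by auto
qed

lemma single_mem_letterplace:
  assumes "in_lp m"
  shows "single m c \<in> letterplace"
proof -
  from assms obtain a b where ab: "a \<le> b" "lookup m (1, a) \<noteq> 0" "lookup m (2, b) \<noteq> 0"
    by (auto simp: in_lp_def)
  define w where "w = expo (1::2, a) + expo (2, b)"
  have "m - w + w = m"
    using ab by (intro expo_diff_add) (auto simp: w_def lookup_add lookup_expo)
  then have "single m c = single (m - w) c * (xvar 1 a * xvar 2 b)"
    by (simp add: xvar_xvar mult_single w_def)
  then show ?thesis using lp_mult_mem[OF letterplace_gen[OF ab(1)]] by simp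
qed

text \<open>The polynomials all of whose monomials satisfy \<open>in_lp\<close> form an ideal, which gives the
  inclusion from left to right.\<close>

lemma mem_letterplace_iff:
  "f \<in> (letterplace :: (2 \<times> 'p::order, 'k::field) mpoly set) \<longleftrightarrow> (\<forall>m. lookup f m \<noteq> 0 \<longrightarrow> in_lp m)"
proof
  assume "\<forall>m. lookup f m \<noteq> 0 \<longrightarrow> in_lp m"
  then have "(\<Sum>m\<in>keys f. single m (lookup f m)) \<in> letterplace"
    by (intro lp_sum_mem single_mem_letterplace) (auto simp: in_keys_iff)
  then show "f \<in> letterplace" by (simp only: monomial_decomposition[symmetric])
next
  interpret RR: cring "PolyRing :: (2 \<times> 'p::order, 'k::field) mpoly ring"
    by (rule cring_from_type_algebra)
  define J where "J = {f :: (2 \<times> 'p, 'k) mpoly. keys f \<subseteq> Collect in_lp}"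
  have "ideal J PolyRing"
  proof (rule ideal_of_type_algebraI)
    show "f + g \<in> J" if "f \<in> J" "g \<in> J" for f g
      using that Poly_Mapping.keys_add[of f g] by (auto simp: J_def)
    show "r * f \<in> J" if "f \<in> J" for r f
      using that keys_mult[of r f] by (auto simp: J_def intro!: in_lp_add)
  qed (simp add: J_def)
  moreover have "{xvar 1 p * xvar 2 q | p q. p \<le> q} \<subseteq> J"
    by (auto simp: J_def xvar_xvar in_lp_def lookup_add lookup_expo)
  ultimately have "letterplace \<subseteq> J"
    unfolding letterplace_def by (rule RR.genideal_minimal)
  moreover assume "f \<in> letterplace"
  ultimately have "f \<in> J" by blast
  then show "\<forall>m. lookup f m \<noteq> 0 \<longrightarrow> in_lp m" by (auto simp: J_def in_keys_iff)
qed

abbreviation contract_at :: "'p \<Rightarrow> (2 \<times> 'p, 'k::field) mpoly \<Rightarrow> (2 \<times> 'p, 'k) mpoly" where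
  "contract_at p \<equiv> contract (expo (1, p) + expo (2, p))"

lemma contract_at_gen:
  "contract_at p (xvar 1 a * xvar 2 b) = (if a = p \<and> b = p then 1 else (0 :: (2 \<times> 'p, 'k::field) mpoly))"
proof (cases "a = p \<and> b = p")
  case True
  then show ?thesis
    using contract_single[of "expo (1, p) + expo (2, p)" 0 1] by (simp add: xvar_xvar)
next
  case False
  have "expo (1::2, a) + expo (2, b) \<noteq> k + (expo (1, p) + expo (2, p))" for k
  proof
    assume eq: "expo (1::2, a) + expo (2, b) = k + (expo (1, p) + expo (2, p))"
    show False using False arg_cong[OF eq, of "\<lambda>m. lookup m (1, p)"] arg_cong[OF eq, of "\<lambda>m. lookup m (2, p)"]
      by (auto simp: lookup_add lookup_expo split: if_splits)
  qed
  then have "contract_at p (single (expo (1, a) + expo (2, b)) 1) = (0 :: (2 \<times> 'p, 'k) mpoly)"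
    by (rule contract_single_eq_0)
  then show ?thesis using False by (simp add: xvar_xvar)
qed

text \<open>Multiplying a monomial \<open>n \<in> L\<close> that is not divisible by \<open>p\<^sub>1p\<^sub>2\<close> by a monomial \<open>k\<close> may make it
  divisible. Then \<open>n\<close> contains \<open>a\<^sub>1b\<^sub>2\<close> with \<open>a \<le> b\<close> and \<open>(a, b) \<noteq> (p, p)\<close>, so that \<open>kn/p\<^sub>1p\<^sub>2\<close> still contains
  \<open>a\<^sub>1\<close> or \<open>b\<^sub>2\<close>, or both, and the two conditions on \<open>r\<close> bring the product into \<open>L\<close>.\<close>

lemma lifts_hom_contract_at:
  fixes r :: "(2 \<times> 'p::order, 'k::field) mpoly"
  assumes above: "\<And>b. p < b \<Longrightarrow> xvar 2 b * r \<in> letterplace"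
    and below: "\<And>a. a < p \<Longrightarrow> xvar 1 a * r \<in> letterplace"
  shows "lifts_hom letterplace (\<lambda>f. r * contract_at p f)"
  unfolding lifts_hom_def
proof (intro conjI ballI allI)
  fix f g
  show "r * contract_at p (f + g) - (r * contract_at p f + r * contract_at p g) \<in> letterplace"
    by (simp add: contract_add distrib_left lp_zero_mem)
next
  fix s f :: "(2 \<times> 'p, 'k) mpoly"
  assume f: "f \<in> letterplace"
  let ?w = "expo (1, p) + expo (2, p)"
  let ?E = "\<lambda>s f. r * contract_at p (s * f) - s * (r * contract_at p f)"
  have mon: "?E (single k c) (single n d) \<in> letterplace" if "in_lp n" for k n c d
  proof (cases "\<exists>n'. n = n' + ?w")
    case True
    then obtain n' where "n = n' + ?w" by blast
    then show ?thesis
      using contract_single[of ?w "k + n'" "c * d"]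
      by (simp add: mult_single contract_single add.assoc mult.left_commute[of _ r] lp_zero_mem)
  next
    case no: False
    then have 0: "contract_at p (single n d) = 0" by (intro contract_single_eq_0) auto
    show ?thesis
    proof (cases "\<exists>m. k + n = m + ?w")
      case False
      then have "contract_at p (single (k + n) (c * d)) = 0" by (intro contract_single_eq_0) auto
      then show ?thesis using 0 by (simp add: mult_single lp_zero_mem)
    next
      case True
      then obtain m where m: "k + n = m + ?w" by blast
      have lk: "lookup k v + lookup n v = lookup m v + lookup ?w v" for v
        using arg_cong[OF m, of "\<lambda>x. lookup x v"] by (simp add: lookup_add)
      from \<open>in_lp n\<close> obtain a b where ab: "a \<le> b" "lookup n (1, a) \<noteq> 0" "lookup n (2, b) \<noteq> 0"
        by (auto simp: in_lp_def)
      have ma: "lookup m (1, a) \<noteq> 0" if "a \<noteq> p"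
        using lk[of "(1, a)"] ab that by (auto simp: lookup_add lookup_expo)
      have mb: "lookup m (2, b) \<noteq> 0" if "b \<noteq> p"
        using lk[of "(2, b)"] ab that by (auto simp: lookup_add lookup_expo)
      have fac: "r * single m (c * d) \<in> letterplace"
        if "lookup m v \<noteq> 0" "Var v * r \<in> letterplace" for v
      proof -
        have "m - expo v + expo v = m"
          using that(1) by (intro expo_diff_add) (auto simp: lookup_expo)
        then have "single m (c * d) = single (m - expo v) (c * d) * Var v"
          by (simp add: Var_expo mult_single)
        then have "r * single m (c * d) = single (m - expo v) (c * d) * (Var v * r)"
          by (simp add: algebra_simps)
        then show ?thesis using lp_mult_mem[OF that(2)] by simp
      qed
      have "\<not> (a = p \<and> b = p)"
      proof
        assume "a = p \<and> b = p"
        then have "n - ?w + ?w = n"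
          using ab by (intro expo_diff_add) (auto simp: lookup_add lookup_expo)
        with no show False by metis
      qed
      then consider "a \<noteq> p" "b \<noteq> p" | "a = p" "b \<noteq> p" | "a \<noteq> p" "b = p" by blast
      then have "r * single m (c * d) \<in> letterplace"
      proof cases
        case 1
        then have "in_lp m" using ma mb ab(1) by (auto simp: in_lp_def)
        then show ?thesis by (intro lp_mult_mem single_mem_letterplace)
      next
        case 2
        then show ?thesis using fac[OF mb] above[of b] ab(1) by simp
      next
        case 3
        then show ?thesis using fac[OF ma] below[of a] ab(1) by simp
      qed
      then show ?thesis using 0 m by (simp add: mult_single contract_single)
    qed
  qed
  have "?E s (single n d) \<in> letterplace" if "in_lp n" for n d
  proof (induction s rule: monomial_induct)
    case (2 s t)
    from lp_add_mem[OF this] show ?case by (simp add: contract_add algebra_simps)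
  qed (rule mon[OF that])
  then have "(\<Sum>m\<in>keys f. ?E s (single m (lookup f m))) \<in> letterplace"
    using f by (intro lp_sum_mem) (auto simp: mem_letterplace_iff in_keys_iff)
  moreover have "(\<Sum>m\<in>A. ?E s (h m)) = ?E s (\<Sum>m\<in>A. h m)" if "finite A" for A and h :: "(2 \<times> 'p \<Rightarrow>\<^sub>0 nat) \<Rightarrow> (2 \<times> 'p, 'k) mpoly"
    using that
  proof (induction A)
    case empty
    have "contract_at p (0 :: (2 \<times> 'p, 'k) mpoly) = 0" by (rule poly_mapping_eqI) (simp add: lookup_contract)
    then show ?case by simp
  qed (simp add: contract_add algebra_simps)
  ultimately show "?E s f \<in> letterplace" by (simp only: monomial_decomposition[symmetric] finite_keys)
qed

section \<open>Rooted trees\<close>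

(* The occurrence of a variable in a monomial is written as a nonzero exponent throughout. *)
declare neq0_conv [iff del]

lemma cover_below:
  assumes "x < (z :: 'p::{finite, order})"
  shows "\<exists>a. covers z a \<and> x \<le> a"
proof -
  obtain m where "m \<in> {w. w < z}" "x \<le> m" "\<And>b. b \<in> {w. w < z} \<Longrightarrow> m \<le> b \<Longrightarrow> m = b"
    using finite_has_maximal2[of "{w. w < z}" x] assms by auto
  then show ?thesis by (intro exI[of _ m]) (auto simp: covers_def order_le_less)
qed

lemma cover_above:
  assumes "x < (z :: 'p::{finite, order})"
  shows "\<exists>c. c \<in> children x \<and> c \<le> z"
proof -
  obtain m where "m \<in> {w. x < w}" "m \<le> z" "\<And>b. b \<in> {w. x < w} \<Longrightarrow> b \<le> m \<Longrightarrow> m = b"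
    using finite_has_minimal2[of "{w. x < w}" z] assms by auto
  then show ?thesis by (intro exI[of _ m]) (auto simp: children_def covers_def order_le_less)
qed

text \<open>If neither of \<open>x\<close> and \<open>y\<close> equals \<open>z\<close>, both lie below the unique element covered by \<open>z\<close>.\<close>

lemma rooted_tree_chain:
  fixes \<rho> x y z :: "'p::{finite, order}"
  assumes "rooted_tree \<rho>" "x \<le> z" "y \<le> z"
  shows "x \<le> y \<or> y \<le> x"
  using assms(2,3)
proof (induction "card {w. w < z}" arbitrary: z rule: less_induct)
  case less
  show ?case
  proof (cases "x = z \<or> y = z")
    case False
    then obtain a a' where a: "covers z a" "x \<le> a" and a': "covers z a'" "y \<le> a'"
      using less.prems cover_below by (metis order_le_less)
    have "z \<noteq> \<rho>" using assms(1) a(1) by (auto simp: rooted_tree_def covers_def)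
    then have "a = a'" using assms(1) a(1) a'(1) by (auto simp: rooted_tree_def)
    moreover have "card {w. w < a} < card {w. w < z}"
      using a(1) by (intro psubset_card_mono) (auto simp: covers_def)
    ultimately show ?thesis using less.hyps a(2) a'(2) by blast
  qed (use less.prems in auto)
qed

lemma covers_parent:
  assumes "rooted_tree \<rho>" "p \<noteq> \<rho>"
  shows "covers p (parent p)"
  unfolding parent_def by (rule theI') (use assms in \<open>auto simp: rooted_tree_def\<close>)

lemma le_parent:
  assumes "rooted_tree (\<rho> :: 'p::{finite, order})" "a < p"
  shows "p \<noteq> \<rho>" "a \<le> parent p"
proof -
  show p: "p \<noteq> \<rho>" using assms by (auto simp: rooted_tree_def)
  obtain c where "covers p c" "a \<le> c" using cover_below[OF assms(2)] by blast
  moreover have "\<exists>!a. covers p a" using assms(1) p by (auto simp: rooted_tree_def)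
  ultimately show "a \<le> parent p" using covers_parent[OF assms(1) p] by metis
qed

section \<open>Decomposition of homomorphisms\<close>

text \<open>The coefficients that the \<open>f i\<close> carry at \<open>m x\<^sub>i\<close> agree whenever they are relevant, that is, when
  \<open>P\<close> holds; a common value can then be chosen as the coefficient of \<open>g\<close> at \<open>m\<close>, and \<open>g\<close> has finite
  support because there are finitely many \<open>f i\<close>.\<close>

lemma glue_coefficients:
  fixes f :: "'j \<Rightarrow> ('v, 'k::field) mpoly"
  assumes J: "finite J"
    and compat: "\<And>i j m. \<lbrakk>i \<in> J; j \<in> J; P (m + expo (x i)); P (m + expo (x j))\<rbrakk>
      \<Longrightarrow> lookup (f i) (m + expo (x i)) = lookup (f j) (m + expo (x j))"
  shows "\<exists>g. \<forall>i\<in>J. \<forall>m. P (m + expo (x i)) \<longrightarrow> lookup g m = lookup (f i) (m + expo (x i))"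
proof -
  define Q where "Q m i \<longleftrightarrow> i \<in> J \<and> P (m + expo (x i))" for m i
  define ch where "ch m = (SOME i. Q m i)" for m
  have ch: "Q m (ch m)" if "Q m i" for m i
    unfolding ch_def using that by (rule someI)
  define c where "c m = (if \<exists>i. Q m i then lookup (f (ch m)) (m + expo (x (ch m))) else 0)" for m
  have "\<exists>g. \<forall>m. lookup g m = c m"
  proof (rule exists_polynomial)
    show "finite (\<Union>i\<in>J. (\<lambda>n. n - expo (x i)) ` keys (f i))" using J by simp
    fix m assume "c m \<noteq> 0"
    then have "Q m (ch m)" and nz: "lookup (f (ch m)) (m + expo (x (ch m))) \<noteq> 0"
      using ch by (auto simp: c_def split: if_splits)
    then show "m \<in> (\<Union>i\<in>J. (\<lambda>n. n - expo (x i)) ` keys (f i))"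
      by (intro UN_I[of "ch m"] image_eqI[of _ _ "m + expo (x (ch m))"]) (auto simp: Q_def in_keys_iff)
  qed
  then obtain g where g: "\<And>m. lookup g m = c m" by blast
  have "lookup g m = lookup (f i) (m + expo (x i))" if "i \<in> J" "P (m + expo (x i))" for i m
  proof -
    have "Q m i" using that by (simp add: Q_def)
    with ch[OF this] compat[of "ch m" i m] that show ?thesis by (auto simp: g c_def Q_def)
  qed
  then show ?thesis by blast
qed

text \<open>A linear syzygy read off at a single monomial outside \<open>L\<close>. The second statement is the case in
  which \<open>v g\<close> cannot contribute, as the monomial lacks \<open>v\<close>.\<close>

lemma coefficient_compat:
  assumes L: "Var w * f - Var v * g \<in> letterplace"
  shows "\<not> in_lp (m + expo v + expo w) \<Longrightarrow> lookup f (m + expo v) = lookup g (m + expo w)"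
    and "\<lbrakk>v \<noteq> w; lookup m v = 0; \<not> in_lp (m + expo w)\<rbrakk> \<Longrightarrow> lookup f m = 0"
proof -
  have 0: "lookup (Var w * f) n = lookup (Var v * g) n" if "\<not> in_lp n" for n
    using L that by (auto simp: mem_letterplace_iff lookup_minus)
  show "lookup f (m + expo v) = lookup g (m + expo w)" if "\<not> in_lp (m + expo v + expo w)"
    using 0[OF that] lookup_Var_mult[of w f "m + expo v"] lookup_Var_mult[of v g "m + expo w"]
    by (simp add: ac_simps)
  show "lookup f m = 0" if "v \<noteq> w" "lookup m v = 0" "\<not> in_lp (m + expo w)"
    using 0[OF that(3)] lookup_Var_mult[of w f m] lookup_Var_mult_eq_0[of "m + expo w" v g] that(1,2)
    by (simp add: lookup_add lookup_expo)
qed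

lemma lookup_add_expo_nonzero: "lookup (m + expo v) w \<noteq> 0 \<longleftrightarrow> lookup m w \<noteq> 0 \<or> w = v"
  by (simp add: lookup_add lookup_expo)

lemma in_lp_add_expoD:
  assumes "\<not> in_lp m"
  shows "in_lp (m + expo (1, a)) \<Longrightarrow> \<exists>t\<ge>a. lookup m (2, t) \<noteq> 0"
    and "in_lp (m + expo (2, b)) \<Longrightarrow> \<exists>s\<le>b. lookup m (1, s) \<noteq> 0"
  using assms unfolding in_lp_def lookup_add_expo_nonzero by auto

text \<open>A generator of \<open>L\<close> involves one variable of each letter, so two variables of the same letter do
  not interact.\<close>

lemma not_in_lp_same_letter:
  assumes "\<not> in_lp (m + expo (i, a))" "\<not> in_lp (m + expo (i, b))"
  shows "\<not> in_lp (m + expo (i, a) + expo (i, b))"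
  using assms unfolding in_lp_def lookup_add_expo_nonzero by fastforce

text \<open>Since \<open>n \<notin> L\<close>, the hypothesis \<open>up\<close> says that \<open>n\<close> contains \<open>s\<^sub>1\<close> for some \<open>s \<le> b'\<close>, and \<open>down\<close> that it
  contains \<open>t\<^sub>2\<close> for some \<open>t \<ge> a'\<close>. No \<open>s\<close> with \<open>s\<^sub>1\<close> in \<open>n\<close> lies below \<open>a\<close>: by \<open>down\<close> at \<open>s\<close> the monomial
  would contain \<open>t\<^sub>2\<close> with \<open>t \<ge> s\<close>. Hence \<open>up\<close> cannot be applicable to \<open>b' = a\<close>, so \<open>a = b\<close>. For a child
  \<open>c\<close> of \<open>a\<close>, \<open>up\<close> yields \<open>s \<le> c\<close>; elements below \<open>c\<close> are comparable with \<open>a\<close>, so \<open>a < s \<le> c\<close> and \<open>s = c\<close>.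
  Finally \<open>down\<close> at the parent of \<open>a\<close> yields \<open>t\<^sub>2\<close>; here \<open>t > a\<close> is impossible, because \<open>n\<close> contains \<open>c\<^sub>1\<close>
  for the child \<open>c\<close> of \<open>a\<close> below \<open>t\<close>, so \<open>t\<close> and \<open>a\<close> meet in the parent.\<close>

lemma surviving_monomial:
  assumes tree: "rooted_tree (\<rho> :: 'p::{finite, order})" and ab: "a \<le> b"
    and n: "\<not> in_lp n" and na: "lookup n (1, a) = 0"
    and up: "\<And>b'. a \<le> b' \<Longrightarrow> b' \<noteq> b \<Longrightarrow> in_lp (n + expo (2, b'))"
    and down: "\<And>a'. a' \<le> b \<Longrightarrow> a' \<noteq> a \<Longrightarrow> in_lp (n + expo (1, a'))"
    and nb: "lookup n (2, b) = 0"
  shows "a = b" "\<And>c. c \<in> children a \<Longrightarrow> lookup n (1, c) \<noteq> 0"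
    "a \<noteq> \<rho> \<Longrightarrow> \<exists>q. is_meet (parent a) q a \<and> lookup n (2, q) \<noteq> 0"
proof -
  have no: False if "s \<le> t" "lookup n (1, s) \<noteq> 0" "lookup n (2, t) \<noteq> 0" for s t
    using n that unfolding in_lp_def by blast
  have down': "\<exists>t\<ge>a'. lookup n (2, t) \<noteq> 0" if "a' \<le> b" "a' \<noteq> a" for a'
    using in_lp_add_expoD(1)[OF n down[OF that]] .
  have not_below: "\<not> s \<le> a" if s: "lookup n (1, s) \<noteq> 0" for s
  proof
    assume "s \<le> a"
    moreover have "s \<noteq> a" using s na by auto
    ultimately show False using down'[of s] no[OF _ s] order_trans[OF _ ab] by blast
  qed
  show eq: "a = b"
  proof (rule ccontr)
    assume "a \<noteq> b"
    then show False using in_lp_add_expoD(2)[OF n up[of a]] not_below by auto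
  qed
  show ch: "lookup n (1, c) \<noteq> 0" if c: "c \<in> children a" for c
  proof -
    have ac: "a < c" using c by (simp add: children_def covers_def)
    then obtain s where s: "s \<le> c" "lookup n (1, s) \<noteq> 0"
      using in_lp_add_expoD(2)[OF n up[of c]] eq by (auto simp: order_less_le)
    have "a < s" using rooted_tree_chain[OF tree s(1), of a] not_below[OF s(2)] ac by (auto simp: order_less_le)
    then have "s = c" using c s(1) by (auto simp: children_def covers_def order_le_less)
    then show ?thesis using s by simp
  qed
  show "\<exists>q. is_meet (parent a) q a \<and> lookup n (2, q) \<noteq> 0" if "a \<noteq> \<rho>"
  proof -
    have pa: "parent a < a" using covers_parent[OF tree that] by (simp add: covers_def)
    then obtain t where t: "parent a \<le> t" "lookup n (2, t) \<noteq> 0"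
      using down'[of "parent a"] eq by (auto simp: order_less_le)
    have "\<not> a \<le> t"
    proof
      assume "a \<le> t"
      moreover have "t \<noteq> a" using t(2) nb eq by auto
      ultimately obtain c where "c \<in> children a" "c \<le> t" using cover_above[of a t] by (auto simp: order_less_le)
      then show False using ch no t(2) by blast
    qed
    then have "is_meet (parent a) t a"
      using t(1) pa le_parent[OF tree] by (auto simp: is_meet_def order_le_less)
    with t show ?thesis by blast
  qed
qed

text \<open>The derivation accounts for the terms of the image of \<open>a\<^sub>1b\<^sub>2\<close> that contain \<open>a\<^sub>1\<close> or \<open>b\<^sub>2\<close>; the polynomial \<open>r p\<close> collects the
  terms of the image of \<open>p\<^sub>1p\<^sub>2\<close> outside \<open>L\<close> that contain neither \<open>p\<^sub>1\<close> nor \<open>p\<^sub>2\<close>.\<close>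

lemma hom_decomposition:
  fixes F :: "(2 \<times> 'p::{finite, order}, 'k::field) mpoly \<Rightarrow> (2 \<times> 'p, 'k) mpoly"
  assumes tree: "rooted_tree \<rho>" and F: "lifts_hom letterplace F"
  shows "\<exists>D\<in>Der. \<exists>r.
    (\<forall>p n. lookup (r p) n \<noteq> 0 \<longrightarrow> (\<forall>c\<in>children p. lookup n (1, c) \<noteq> 0) \<and>
      (p \<noteq> \<rho> \<longrightarrow> (\<exists>q. is_meet (parent p) q p \<and> lookup n (2, q) \<noteq> 0))) \<and>
    (\<forall>a b. a \<le> b \<longrightarrow> F (xvar 1 a * xvar 2 b) -
      (D (xvar 1 a * xvar 2 b) + (\<Sum>p\<in>UNIV. r p * contract_at p (xvar 1 a * xvar 2 b))) \<in> letterplace)"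
proof -
  define f where "f a b = F (xvar 1 a * xvar 2 b)" for a b
  \<comment> \<open>\<open>w y = v z\<close> is one element of \<open>L\<close>, and \<open>F\<close> is linear on \<open>L\<close> modulo \<open>L\<close>\<close>
  have syz: "Var w * F y - Var v * F z \<in> letterplace"
    if "y \<in> letterplace" "z \<in> letterplace" "Var w * y = Var v * z" for v w y z
  proof -
    have "F (Var w * y) - Var w * F y \<in> letterplace" "F (Var v * z) - Var v * F z \<in> letterplace"
      using F that(1,2) by (auto simp: lifts_hom_def)
    from lp_diff_mem[OF this(2,1)] show ?thesis using that(3) by (simp add: algebra_simps)
  qed
  have syz2: "xvar 2 b' * f a b - xvar 2 b * f a b' \<in> letterplace" if "a \<le> b" "a \<le> b'" for a b b'
    unfolding f_def by (rule syz) (use that in \<open>auto simp: letterplace_gen ac_simps\<close>)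
  have syz1: "xvar 1 a' * f a b - xvar 1 a * f a' b \<in> letterplace" if "a \<le> b" "a' \<le> b" for a a' b
    unfolding f_def by (rule syz) (use that in \<open>auto simp: letterplace_gen ac_simps\<close>)

  have "\<exists>g. \<forall>b\<in>{b. a \<le> b}. \<forall>m. \<not> in_lp (m + expo (2, b)) \<longrightarrow> lookup g m = lookup (f a b) (m + expo (2, b))" for a
    by (rule glue_coefficients)
      (simp, rule coefficient_compat(1)[OF syz2 not_in_lp_same_letter], auto)
  then obtain g where g: "\<And>a b m. a \<le> b \<Longrightarrow> \<not> in_lp (m + expo (2, b)) \<Longrightarrow>
      lookup (g a) m = lookup (f a b) (m + expo (2, b))"
    unfolding Ball_def mem_Collect_eq by metis
  have "\<exists>h. \<forall>a\<in>{a. a \<le> b}. \<forall>m. \<not> in_lp (m + expo (1, a)) \<longrightarrow> lookup h m = lookup (f a b) (m + expo (1, a))" for b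
    by (rule glue_coefficients)
      (simp, rule coefficient_compat(1)[OF syz1 not_in_lp_same_letter], auto)
  then obtain h where h: "\<And>a b m. a \<le> b \<Longrightarrow> \<not> in_lp (m + expo (1, a)) \<Longrightarrow>
      lookup (h b) m = lookup (f a b) (m + expo (1, a))"
    unfolding Ball_def mem_Collect_eq by metis
  obtain D where D: "D \<in> Der" and DV: "\<And>v. D (Var v) = (if fst v = 1 then g (snd v) else h (snd v))"
    using derivation_exists[of "\<lambda>v. if fst v = 1 then g (snd v) else h (snd v)"] by blast
  have DG: "D (xvar 1 a * xvar 2 b) = xvar 1 a * h b + xvar 2 b * g a" for a b
    using D by (simp add: Der_def DV)

  have "\<exists>r. \<forall>n. lookup r n = (if \<not> in_lp n \<and> lookup n (1, p) = 0 \<and> lookup n (2, p) = 0 then lookup (f p p) n else 0)" for p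
    by (rule exists_polynomial[of "keys (f p p)"]) (auto simp: in_keys_iff split: if_splits)
  then obtain r where r: "\<And>p n. lookup (r p) n =
      (if \<not> in_lp n \<and> lookup n (1, p) = 0 \<and> lookup n (2, p) = 0 then lookup (f p p) n else 0)"
    by metis
  have surv: "in_lp (n + expo (2, b'))" if "lookup (f a b) n \<noteq> 0" "lookup n (2, b) = 0" "a \<le> b" "a \<le> b'" "b' \<noteq> b" for a b b' n
    using coefficient_compat(2)[OF syz2[of a b b'], of n] that by auto
  have surv': "in_lp (n + expo (1, a'))" if "lookup (f a b) n \<noteq> 0" "lookup n (1, a) = 0" "a \<le> b" "a' \<le> b" "a' \<noteq> a" for a a' b n
    using coefficient_compat(2)[OF syz1[of a b a'], of n] that by auto
  note sm = surviving_monomial[OF tree _ _ _ surv surv']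

  show ?thesis
  proof (intro bexI[OF _ D] exI[of _ r] conjI allI impI ballI)
    show "lookup n (1, c) \<noteq> 0" if "lookup (r p) n \<noteq> 0" "c \<in> children p" for p n c
      by (rule sm(2)[of p p]) (use that in \<open>auto simp: r split: if_splits\<close>)
    show "\<exists>q. is_meet (parent p) q p \<and> lookup n (2, q) \<noteq> 0" if "lookup (r p) n \<noteq> 0" "p \<noteq> \<rho>" for p n
      by (rule sm(3)[of p p]) (use that in \<open>auto simp: r split: if_splits\<close>)
    fix a b :: 'p assume ab: "a \<le> b"
    have sum: "(\<Sum>p\<in>UNIV. r p * contract_at p (xvar 1 a * xvar 2 b)) = (if a = b then r a else 0)"
    proof -
      have "r p * contract_at p (xvar 1 a * xvar 2 b) = (if p = a then if a = b then r a else 0 else 0)" for p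
        by (auto simp: contract_at_gen)
      then show ?thesis by simp
    qed
    have "lookup (f a b) n = lookup (xvar 1 a * h b) n + lookup (xvar 2 b * g a) n
        + lookup (if a = b then r a else 0) n" if n: "\<not> in_lp n" for n
    proof -
      have split: "n - expo v + expo v = n" if "lookup n v \<noteq> 0" for v
        using that by (intro expo_diff_add) (auto simp: lookup_expo)
      \<comment> \<open>a monomial containing both \<open>a\<^sub>1\<close> and \<open>b\<^sub>2\<close> lies in \<open>L\<close>\<close>
      consider "lookup n (1, a) \<noteq> 0" "lookup n (2, b) = 0" | "lookup n (1, a) = 0" "lookup n (2, b) \<noteq> 0"
        | "lookup n (1, a) = 0" "lookup n (2, b) = 0"
        using n ab by (auto simp: in_lp_def)
      then show ?thesis
      proof cases
        case 1
        have "lookup (xvar 1 a * h b) n = lookup (f a b) n"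
          using h[OF ab, of "n - expo (1, a)"] lookup_Var_mult[of "(1, a)" "h b" "n - expo (1, a)"]
            split[OF 1(1)] n by simp
        then show ?thesis using 1 by (auto simp: lookup_Var_mult_eq_0 r)
      next
        case 2
        have "lookup (xvar 2 b * g a) n = lookup (f a b) n"
          using g[OF ab, of "n - expo (2, b)"] lookup_Var_mult[of "(2, b)" "g a" "n - expo (2, b)"]
            split[OF 2(2)] n by simp
        then show ?thesis using 2 by (auto simp: lookup_Var_mult_eq_0 r)
      next
        case 3
        have "a = b" if "lookup (f a b) n \<noteq> 0"
          by (rule sm(1)[of a b n]) (use that 3 n ab in auto)
        then show ?thesis using 3 n by (auto simp: lookup_Var_mult_eq_0 r)
      qed
    qed
    then have "in_lp n" if "lookup (F (xvar 1 a * xvar 2 b) -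
        (xvar 1 a * h b + xvar 2 b * g a + (if a = b then r a else 0))) n \<noteq> 0" for n
      using that by (auto simp: lookup_minus lookup_add f_def)
    then show "F (xvar 1 a * xvar 2 b) - (D (xvar 1 a * xvar 2 b) +
        (\<Sum>p\<in>UNIV. r p * contract_at p (xvar 1 a * xvar 2 b))) \<in> letterplace"
      unfolding DG sum mem_letterplace_iff by blast
  qed
qed

section \<open>Classes in the first cotangent cohomology\<close>

lemma DerD:
  assumes "D \<in> Der"
  shows "D (f + g) = D f + D g" "D (Cst c * f) = Cst c * D f" "D (f * g) = f * D g + g * D f"
  using assms unfolding Der_def by blast+

lemma DerI:
  assumes "\<And>f g. D (f + g) = D f + D g" "\<And>c f. D (Cst c * f) = Cst c * D f"
    and "\<And>f g. D (f * g) = f * D g + g * D f"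
  shows "D \<in> Der"
  using assms by (simp add: Der_def)

lemma Der_add:
  assumes "D \<in> Der" "E \<in> Der"
  shows "(\<lambda>f. D f + E f) \<in> Der"
proof (rule DerI)
  show "D (f + g) + E (f + g) = D f + E f + (D g + E g)" for f g
    by (simp add: DerD(1)[OF assms(1)] DerD(1)[OF assms(2)])
  show "D (Cst c * f) + E (Cst c * f) = Cst c * (D f + E f)" for c f
    by (simp add: DerD(2)[OF assms(1)] DerD(2)[OF assms(2)] distrib_left)
  show "D (f * g) + E (f * g) = f * (D g + E g) + g * (D f + E f)" for f g
    by (simp add: DerD(3)[OF assms(1)] DerD(3)[OF assms(2)] distrib_left)
qed

lemma Der_mult:
  assumes "D \<in> Der"
  shows "(\<lambda>f. r * D f) \<in> Der"
proof (rule DerI)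
  show "r * D (f + g) = r * D f + r * D g" for f g
    by (simp add: DerD(1)[OF assms] distrib_left)
  show "r * D (Cst c * f) = Cst c * (r * D f)" for c f
    by (simp add: DerD(2)[OF assms] mult.left_commute)
  show "r * D (f * g) = f * (r * D g) + g * (r * D f)" for f g
    by (simp add: DerD(3)[OF assms] distrib_left mult.left_commute)
qed

text \<open>By the Leibniz rule a derivation fails to be linear by a multiple of its argument, which
  vanishes modulo \<open>L\<close> on \<open>L\<close>.\<close>

lemma lifts_hom_Der:
  assumes "D \<in> Der"
  shows "lifts_hom letterplace (D :: (2 \<times> 'p::order, 'k::field) mpoly \<Rightarrow> _)"
proof -
  have "D (r * f) - r * D f = D r * f" for r f
    by (simp add: DerD(3)[OF assms] mult.commute)
  then show ?thesis
    by (auto simp: lifts_hom_def DerD(1)[OF assms] lp_zero_mem intro: lp_mult_mem)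
qed

lemma delta_eq_hom_of: "delta L D = hom_of L D"
  by (simp add: delta_def hom_of_def)

lemma delta_Der_submodule:
  "submodule (delta letterplace ` Der) PolyRing
     (Hom_quot PolyRing (letterplace :: (2 \<times> 'p::order, 'k::field) mpoly set))"
    (is "submodule ?K _ ?H")
proof -
  interpret lp: type_ideal "letterplace :: (2 \<times> 'p::order, 'k::field) mpoly set"
    by (rule type_ideal_letterplace)
  interpret H: module PolyRing ?H by (rule lp.Hom_quot_module)
  note simps = delta_eq_hom_of lp.Hom_quot_simps lp.hom_of_carrier_iff
  show ?thesis
  proof (rule H.submoduleI)
    show sub: "?K \<subseteq> carrier ?H" by (auto simp: simps lifts_hom_Der)
    show zero: "\<zero>\<^bsub>?H\<^esub> \<in> ?K"
      unfolding simps delta_eq_hom_of by (rule image_eqI[OF refl]) (simp add: Der_def)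
    show "a \<oplus>\<^bsub>?H\<^esub> b \<in> ?K" if "a \<in> ?K" "b \<in> ?K" for a b
    proof -
      obtain D E where "a = hom_of letterplace D" "b = hom_of letterplace E" "D \<in> Der" "E \<in> Der"
        using \<open>a \<in> ?K\<close> \<open>b \<in> ?K\<close> by (auto simp: delta_eq_hom_of)
      moreover from this have "(\<lambda>f. D f + E f) \<in> Der"
        by (intro Der_add)
      ultimately show ?thesis by (auto simp: simps delta_eq_hom_of)
    qed
    show smult: "r \<odot>\<^bsub>?H\<^esub> a \<in> ?K" if "a \<in> ?K" for r a
    proof -
      obtain D where "a = hom_of letterplace D" "D \<in> Der"
        using \<open>a \<in> ?K\<close> by (auto simp: delta_eq_hom_of)
      moreover from this have "(\<lambda>f. r * D f) \<in> Der"
        by (intro Der_mult)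
      ultimately show ?thesis by (auto simp: simps delta_eq_hom_of)
    qed
    show "\<ominus>\<^bsub>?H\<^esub> a \<in> ?K" if "a \<in> ?K" for a
    proof -
      obtain D where D: "a = hom_of letterplace D" "D \<in> Der"
        using \<open>a \<in> ?K\<close> by (auto simp: delta_eq_hom_of)
      have "\<ominus>\<^bsub>?H\<^esub> a = (- 1) \<odot>\<^bsub>?H\<^esub> a"
        by (rule H.minus_equality) (use lifts_hom_Der[OF D(2)] lifts_hom_Der[OF Der_mult[OF D(2), of "- 1"]] in \<open>auto simp: simps D(1)\<close>)
      with smult[OF that] show ?thesis by simp
    qed
  qed
qed

lemma lifts_hom_eqI:
  assumes F: "lifts_hom letterplace F" and G: "lifts_hom letterplace G"
    and eq: "\<And>a b. a \<le> b \<Longrightarrow> F (xvar 1 a * xvar 2 b) - G (xvar 1 a * xvar 2 b)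
      \<in> (letterplace :: (2 \<times> 'p::order, 'k::field) mpoly set)"
  shows "hom_of letterplace F = hom_of letterplace G"
proof -
  interpret lp: type_ideal "letterplace :: (2 \<times> 'p::order, 'k::field) mpoly set"
    by (rule type_ideal_letterplace)
  have "lifts_hom letterplace (\<lambda>f. F f + (- 1) * G f)"
    by (intro lp.lifts_hom_add lp.lifts_hom_mult F G)
  from lifts_hom_zero_on_genideal[OF letterplace_def this] show ?thesis
    unfolding lp.hom_of_eq_iff using eq by auto
qed

text \<open>Two homomorphisms that agree on the generators of \<open>L\<close> are equal, so the explicit special
  homomorphism is the only one.\<close>

lemma special_homs_eq:
  fixes r :: "(2 \<times> 'p::order, 'k::field) mpoly"
  assumes "\<And>b. p < b \<Longrightarrow> xvar 2 b * r \<in> letterplace" "\<And>a. a < p \<Longrightarrow> xvar 1 a * r \<in> letterplace"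
  shows "special_homs letterplace p r = {hom_of letterplace (\<lambda>f. r * contract_at p f)}"
proof -
  interpret lp: type_ideal "letterplace :: (2 \<times> 'p::order, 'k::field) mpoly set"
    by (rule type_ideal_letterplace)
  have S: "lifts_hom letterplace (\<lambda>f. r * contract_at p f)"
    using assms by (rule lifts_hom_contract_at)
  have "\<phi> = hom_of letterplace (\<lambda>f. r * contract_at p f)" if "\<phi> \<in> special_homs letterplace p r" for \<phi>
  proof -
    obtain F where F: "\<phi> = hom_of letterplace F" "lifts_hom letterplace F"
      using \<open>\<phi> \<in> _\<close> lp.carrier_hom_ofE by (auto simp: special_homs_def)
    show ?thesis
      unfolding F(1)
    proof (rule lifts_hom_eqI[OF F(2) S])
      fix a b :: 'p assume "a \<le> b"
      with that have "letterplace +>\<^bsub>PolyRing\<^esub> F (xvar 1 a * xvar 2 b)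
          = letterplace +>\<^bsub>PolyRing\<^esub> (if (a, b) = (p, p) then r else 0)"
        by (auto simp: special_homs_def F hom_of_def lp.quot_simps letterplace_gen)
      then show "F (xvar 1 a * xvar 2 b) - r * contract_at p (xvar 1 a * xvar 2 b) \<in> letterplace"
        unfolding lp.coset_eq_iff by (cases "a = p \<and> b = p") (auto simp: contract_at_gen)
    qed
  qed
  moreover have "hom_of letterplace (\<lambda>f. r * contract_at p f) \<in> special_homs letterplace p r"
    using S by (auto simp: special_homs_def lp.hom_of_carrier_iff)
      (auto simp: hom_of_def contract_at_gen letterplace_gen lp.quot_simps)
  ultimately show ?thesis by blast
qed

text \<open>Some child \<open>c\<close> of \<open>p\<close> lies below \<open>b\<close>, and \<open>c\<^sub>1b\<^sub>2\<close> is a generator.\<close>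

lemma xvar2_mult_children_mem:
  assumes "p < (b :: 'p::{finite, order})"
  shows "xvar 2 b * (\<Prod>c\<in>children p. xvar 1 c) \<in> (letterplace :: (2 \<times> 'p, 'k::field) mpoly set)"
proof -
  obtain c where c: "c \<in> children p" "c \<le> b" using cover_above[OF assms] by blast
  have "xvar 2 b * (\<Prod>c\<in>children p. xvar 1 c :: (2 \<times> 'p, 'k) mpoly)
      = (\<Prod>c\<in>children p - {c}. xvar 1 c) * (xvar 1 c * xvar 2 b)"
    using c(1) by (simp add: prod.remove[of _ c] algebra_simps)
  then show ?thesis using lp_mult_mem[OF letterplace_gen[OF c(2)]] by simp
qed

lemma special_homs_nonroot_eq:
  assumes tree: "rooted_tree (\<rho> :: 'p::{finite, order})" and meet: "is_meet (parent p) q p"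
  defines "w \<equiv> xvar 2 q * (\<Prod>b\<in>children p. xvar 1 b) :: (2 \<times> 'p, 'k::field) mpoly"
  shows "special_homs letterplace p w = {hom_of letterplace (\<lambda>f. w * contract_at p f)}"
proof (rule special_homs_eq)
  show "xvar 2 b * w \<in> letterplace" if "p < b" for b
    using lp_mult_mem[OF xvar2_mult_children_mem[OF that], of "xvar 2 q"]
    by (simp add: w_def mult.left_commute)
  show "xvar 1 a * w \<in> letterplace" if "a < p" for a
  proof -
    have "a \<le> q" using le_parent(2)[OF tree that] meet by (auto simp: is_meet_def)
    from lp_mult_mem[OF letterplace_gen[OF this], of "\<Prod>b\<in>children p. xvar 1 b"]
    show ?thesis by (simp add: w_def mult_ac)
  qed
qed

lemma special_homs_root_eq:
  assumes tree: "rooted_tree (\<rho> :: 'p::{finite, order})"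
  shows "special_homs letterplace \<rho> (\<Prod>b\<in>children \<rho>. xvar 1 b :: (2 \<times> 'p, 'k::field) mpoly)
    = {hom_of letterplace (\<lambda>f. (\<Prod>b\<in>children \<rho>. xvar 1 b) * contract_at \<rho> f)}"
proof (rule special_homs_eq)
  show "xvar 2 b * (\<Prod>c\<in>children \<rho>. xvar 1 c) \<in> (letterplace :: (2 \<times> 'p, 'k) mpoly set)" if "\<rho> < b" for b
    by (rule xvar2_mult_children_mem[OF that])
qed (use le_parent[OF tree] in auto)

text \<open>Membership in an ideal \<open>M\<close> of polynomials follows if every monomial that occurs is divisible by a
  monomial in \<open>M\<close>.
  Below, \<open>M\<close> consists of the values at \<open>p\<^sub>1p\<^sub>2\<close> of the homomorphisms lying in a given submodule.\<close>

lemma mem_of_monomials: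
  assumes zero: "0 \<in> M" and add: "\<And>f g. f \<in> M \<Longrightarrow> g \<in> M \<Longrightarrow> f + g \<in> M"
    and mult: "\<And>r f. f \<in> M \<Longrightarrow> r * f \<in> M"
    and mon: "\<And>n. lookup r n \<noteq> 0 \<Longrightarrow> \<exists>w. single w 1 \<in> M \<and> (\<forall>v. lookup w v \<le> lookup n v)"
  shows "r \<in> (M :: ('v, 'k::field) mpoly set)"
proof -
  have "single n (lookup r n) \<in> M" if n: "n \<in> keys r" for n
  proof -
    obtain w where w: "single w 1 \<in> M" "\<And>v. lookup w v \<le> lookup n v"
      using mon[of n] n unfolding in_keys_iff by blast
    have "single n (lookup r n) = single (n - w) (lookup r n) * single w 1"
      using expo_diff_add[OF w(2)] by (simp add: mult_single)
    then show ?thesis using mult[OF w(1)] by simp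
  qed
  then have "(\<Sum>n\<in>A. single n (lookup r n)) \<in> M" if "A \<subseteq> keys r" for A
    using that by (induction A rule: infinite_finite_induct) (auto simp: zero add)
  from this[of "keys r"] show ?thesis by (simp only: monomial_decomposition[symmetric] subset_refl)
qed

theorem corollary6p11:
  fixes \<rho> :: "'p::{finite, order}"
    and L :: "(2 \<times> 'p, 'k::field) mpoly set"
  assumes tree: "rooted_tree \<rho>"
    and L: "L = letterplace"
  shows
    "(\<forall>p q. p \<noteq> \<rho> \<and> is_meet (parent p) q p \<longrightarrow>
        (\<exists>!\<phi>. \<phi> \<in> special_homs L p (xvar 2 q * (\<Prod>b\<in>children p. xvar 1 b))) \<and>
        (\<forall>\<phi> \<in> special_homs L p (xvar 2 q * (\<Prod>b\<in>children p. xvar 1 b)).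
            T1_class L \<phi> \<in> carrier (T1 L)))
     \<and> (\<exists>!\<phi>. \<phi> \<in> special_homs L \<rho> (\<Prod>b\<in>children \<rho>. xvar 1 b))
     \<and> (\<forall>\<phi> \<in> special_homs L \<rho> (\<Prod>b\<in>children \<rho>. xvar 1 b). T1_class L \<phi> \<in> carrier (T1 L))
     \<and> module_span PolyRing (T1 L)
         ({T1_class L \<phi> | \<phi> p q. p \<noteq> \<rho> \<and> is_meet (parent p) q p \<and>
              \<phi> \<in> special_homs L p (xvar 2 q * (\<Prod>b\<in>children p. xvar 1 b))}
          \<union> {T1_class L \<phi> | \<phi>. \<phi> \<in> special_homs L \<rho> (\<Prod>b\<in>children \<rho>. xvar 1 b)})
       = carrier (T1 L)"
proof -
  interpret lp: type_ideal L unfolding L by (rule type_ideal_letterplace)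
  define K where "K = delta L ` Der"
  define Sp where "Sp = (\<lambda>p r. hom_of L (\<lambda>f. r * contract_at p f))"
  define wt :: "'p \<Rightarrow> (2 \<times> 'p, 'k) mpoly" where "wt = (\<lambda>p. \<Prod>b\<in>children p. xvar 1 b)"
  define A where "A = {Sp p (xvar 2 q * wt p) | p q. p \<noteq> \<rho> \<and> is_meet (parent p) q p} \<union> {Sp \<rho> (wt \<rho>)}"
  have nonroot: "special_homs L p (xvar 2 q * (\<Prod>b\<in>children p. xvar 1 b)) = {Sp p (xvar 2 q * wt p)}"
    if "is_meet (parent p) q p" for p q
    unfolding L Sp_def wt_def by (rule special_homs_nonroot_eq[OF tree that])
  have root: "special_homs L \<rho> (\<Prod>b\<in>children \<rho>. xvar 1 b) = {Sp \<rho> (wt \<rho>)}"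
    unfolding L Sp_def wt_def by (rule special_homs_root_eq[OF tree])
  have T1: "T1 L = quot_module lp.HH K" "T1_class L = (\<lambda>\<phi>. K +>\<^bsub>lp.HH\<^esub> \<phi>)"
    by (auto simp: T1_def T1_class_def K_def)
  have H: "module PolyRing lp.HH" by (rule lp.Hom_quot_module)
  have K: "submodule K PolyRing lp.HH" unfolding K_def L by (rule delta_Der_submodule)
  have A_carrier: "A \<subseteq> carrier lp.HH"
  proof -
    have "special_homs L p r \<subseteq> carrier lp.HH" for p r by (auto simp: special_homs_def)
    with nonroot root show ?thesis unfolding A_def by blast
  qed
  have gens: "{T1_class L \<phi> | \<phi> p q. p \<noteq> \<rho> \<and> is_meet (parent p) q p \<and>
              \<phi> \<in> special_homs L p (xvar 2 q * (\<Prod>b\<in>children p. xvar 1 b))}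
          \<union> {T1_class L \<phi> | \<phi>. \<phi> \<in> special_homs L \<rho> (\<Prod>b\<in>children \<rho>. xvar 1 b)}
     = T1_class L ` A" (is "?G1 \<union> ?G2 = _")
  proof -
    have "?G1 = T1_class L ` {Sp p (xvar 2 q * wt p) | p q. p \<noteq> \<rho> \<and> is_meet (parent p) q p}"
      using nonroot by fast
    then show ?thesis unfolding A_def image_Un root by blast
  qed
  have span: "module_span PolyRing (T1 L) (T1_class L ` A) = carrier (T1 L)"
    unfolding T1
  proof (rule module_span_quot_module[OF H K A_carrier])
    fix N x
    assume AN: "A \<subseteq> N" and KN: "K \<subseteq> N" and N: "N \<subseteq> carrier lp.HH"
      and add: "\<And>x y. x \<in> N \<Longrightarrow> y \<in> N \<Longrightarrow> x \<oplus>\<^bsub>lp.HH\<^esub> y \<in> N"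
      and smult: "\<And>r x. r \<in> carrier PolyRing \<Longrightarrow> x \<in> N \<Longrightarrow> r \<odot>\<^bsub>lp.HH\<^esub> x \<in> N"
      and x: "x \<in> carrier lp.HH"
    obtain F where F: "x = hom_of L F" "lifts_hom L F" using x by (rule lp.carrier_hom_ofE)
    obtain D r where D: "D \<in> Der"
      and r: "\<forall>p n. lookup (r p) n \<noteq> 0 \<longrightarrow> (\<forall>c\<in>children p. lookup n (1, c) \<noteq> 0) \<and>
        (p \<noteq> \<rho> \<longrightarrow> (\<exists>q. is_meet (parent p) q p \<and> lookup n (2, q) \<noteq> 0))"
      and dec: "\<forall>a b. a \<le> b \<longrightarrow> F (xvar 1 a * xvar 2 b) -
        (D (xvar 1 a * xvar 2 b) + (\<Sum>p\<in>UNIV. r p * contract_at p (xvar 1 a * xvar 2 b))) \<in> letterplace"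
      using hom_decomposition[OF tree F(2)[unfolded L]] by (elim bexE exE conjE) (rule that)
    have zero: "hom_of L (\<lambda>f. 0) \<in> N"
    proof -
      have "(\<lambda>f. 0) \<in> Der" by (simp add: Der_def)
      then show ?thesis using KN by (auto simp: K_def delta_eq_hom_of)
    qed
    have Sp: "Sp p (r p) \<in> N" for p
    proof -
      \<comment> \<open>an ideal containing the monomials prescribed for \<open>p\<close>, hence also \<open>r p\<close>\<close>
      define M where "M = {s. Sp p s \<in> N}"
      have "r p \<in> M"
      proof (rule mem_of_monomials)
        show "0 \<in> M" using zero by (simp add: M_def Sp_def)
        show "f + g \<in> M" if "f \<in> M" "g \<in> M" for f g
          using add[of "Sp p f" "Sp p g"] that by (simp add: M_def Sp_def lp.Hom_quot_simps distrib_right)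
        show "s * f \<in> M" if "f \<in> M" for s f
          using smult[of s "Sp p f"] that by (simp add: M_def Sp_def lp.Hom_quot_simps mult.assoc)
        fix n assume n: "lookup (r p) n \<noteq> 0"
        define u :: "2 \<times> 'p \<Rightarrow>\<^sub>0 nat" where "u = (\<Sum>c\<in>children p. expo (1, c))"
        have wt: "wt p = single u 1" unfolding wt_def u_def by (rule prod_Var)
        have u: "lookup u v = (if fst v = 1 \<and> snd v \<in> children p then 1 else 0)" for v
          by (cases v) (auto simp: u_def lookup_sum lookup_expo)
        have le: "lookup u v \<le> lookup n v" for v
          using r n by (cases v) (auto simp: u Suc_le_eq neq0_conv)
        show "\<exists>w. single w 1 \<in> M \<and> (\<forall>v. lookup w v \<le> lookup n v)"
        proof (cases "p = \<rho>")
          case True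
          then have "single u 1 \<in> M" using AN wt by (auto simp: M_def A_def)
          with le show ?thesis by blast
        next
          case False
          then obtain q where q: "is_meet (parent p) q p" "lookup n (2, q) \<noteq> 0"
            using r n by blast
          have "single (expo (2, q) + u) 1 = xvar 2 q * wt p"
            by (simp add: wt Var_expo mult_single)
          then have "single (expo (2, q) + u) 1 \<in> M" using AN q(1) False by (auto simp: M_def A_def)
          moreover have "lookup (expo (2, q) + u) v \<le> lookup n v" for v
            using le[of v] q(2) by (auto simp: lookup_add lookup_expo u)
          ultimately show ?thesis by blast
        qed
      qed
      then show ?thesis by (simp add: M_def)
    qed
    have sum: "hom_of L (\<lambda>f. \<Sum>p\<in>B. r p * contract_at p f) \<in> N" if "finite B" for B
      using that
    proof (induction B)
      case (insert p B)
      from add[OF Sp[of p] insert.IH] show ?case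
        using insert.hyps by (simp add: Sp_def lp.Hom_quot_simps)
    qed (simp add: zero)
    have "hom_of L D \<in> N" using D KN by (auto simp: K_def delta_eq_hom_of)
    from add[OF this sum[of UNIV]]
    have G: "hom_of L (\<lambda>f. D f + (\<Sum>p\<in>UNIV. r p * contract_at p f)) \<in> N"
      by (simp add: lp.Hom_quot_simps)
    then have "lifts_hom L (\<lambda>f. D f + (\<Sum>p\<in>UNIV. r p * contract_at p f))"
      using N lp.hom_of_carrier_iff by blast
    then have "x = hom_of L (\<lambda>f. D f + (\<Sum>p\<in>UNIV. r p * contract_at p f))"
      unfolding F(1) L by (intro lifts_hom_eqI) (use F(2) dec in \<open>simp_all add: L\<close>)
    with G show "x \<in> N" by simp
  qed
  have mem_T1: "T1_class L \<phi> \<in> carrier (T1 L)" if "\<phi> \<in> special_homs L p s" for \<phi> p s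
    using that by (auto simp: T1 quot_module_carrier special_homs_def)
  show ?thesis
    unfolding gens
    by (intro conjI allI impI ballI) (erule mem_T1 | simp add: nonroot root span)+
qed

end
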